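(* Let $p:\Omega\to\Lambda$ be a connected covering of $k$-graphs, $x\in\Lambda^0$, and $v\in p^{-1}(x)$. Then the normalizer $N(p_*\pi(\Omega,v))$ of $p_*\pi(\Omega,v)$ in $\pi(\Lambda,x)$ acts on $(\Omega,p)$ by covering automorphisms (via the action described in the context), and in fact \[ \operatorname{Aut}(\Omega,p)\cong N(p_*\pi(\Omega,v))/p_*\pi(\Omega,v). \]
   Context: A $k$-graph is a small category $\Lambda$ with a functor $d:\Lambda\to\mathbb N^k$ (the degree) satisfying the factorization property: if $d(\alpha)=n+l$ with $n,l\in\mathbb N^k$, there are unique $\beta,\gamma\in\Lambda$ with $d(\beta)=n$, $d(\gamma)=l$, $\alpha=\beta\gamma$. $\Lambda^0$ is the set of objects (vertices, identified with identity morphisms); $s(\alpha)$ and $r(\alpha)$ are the domain and codomain of $\alpha$. $u\mathcal C=r^{-1}(u)$, $\mathcal C v=s^{-1}(v)$, $u\mathcal Cv=u\mathcal C\cap\mathcal Cv$. A small category $\mathcal C$ is connected if the equivalence relation on $\mathcal C^0$ generated by $\{(u,v)\mid u\mathcal Cv\neq\emptyset\}$ is all of $\mathcal C^0\times\mathcal C^0$. A $k$-graph morphism is a degree-preserving functor. A covering of $\Lambda$ is a surjective $k$-graph morphism $p:\Omega\to\Lambda$ such that for all $v\in\Omega^0$, $p$ maps $\Omega v$ bijectively onto $\Lambda p(v)$ and $v\Omega$ bijectively onto $p(v)\Lambda$. It is connected if $\Omega$ (hence $\Lambda$) is connected. For $x\in\Lambda^0$, $p^{-1}(x)$ consists of vertices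 of $\Omega$. $\operatorname{Aut}(\Omega,p)$ is the group of $k$-graph automorphisms $\phi$ of $\Omega$ with $p\circ\phi=p$. The fundamental groupoid of $\Lambda$ is the groupoid $\mathcal G(\Lambda)$ with $\mathcal G(\Lambda)^0=\Lambda^0$, together with a functor $i:\Lambda\to\mathcal G(\Lambda)$ that is the identity on $\Lambda^0$, such that every functor from $\Lambda$ to a groupoid factors uniquely through $i$. The fundamental group at $x\in\Lambda^0$ is $\pi(\Lambda,x)=x\mathcal G(\Lambda)x$. A covering $p$ induces homomorphisms $p_*:\pi(\Omega,v)\to\pi(\Lambda,p(v))$. $\mathcal G(\Lambda)$ acts on $\Omega^0$: each $a\in x\mathcal G(\Lambda)y$ gives a bijection $u\mapsto au$ from $p^{-1}(y)$ to $p^{-1}(x)$, functorially, determined by $i(\alpha)u=r(\lambda)$ if $\alpha=p(\lambda)$ and $u=s(\lambda)$ with $\lambda\in\Omega$. For a connected covering this action is transitive ($\Omega^0=\mathcal G(\Lambda)v$). The (right) action of $c\in N(p_*\pi(\Omega,v))$ on $\lambda\in\Omega$: choose $a\in\mathcal G(\Lambda)$ with $s(\lambda)=av$; then $\lambda c$ is the unique element of $\Omega$ with $p(\lambda c)=p(\lambda)$ and $s(\lambda c)=acv$. *)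

theory Defs
  imports "HOL-Algebra.Group_Action" "HOL-Library.Function_Algebras"
begin

section \<open>Small categories and functors\<close>

record ('v, 'e) small_cat =
  Obj :: "'v set"
  Arr :: "'e set"
  src :: "'e \<Rightarrow> 'v"
  rng :: "'e \<Rightarrow> 'v"
  idn :: "'v \<Rightarrow> 'e"
  cmp :: "'e \<Rightarrow> 'e \<Rightarrow> 'e"

text \<open>Composition is written as in the theory of \<open>k\<close>-graphs: \<open>cmp C f g\<close>, the product \<open>fg\<close>,
  is meaningful if \<open>src f = rng g\<close>.\<close>

definition category :: "('v, 'e, 'z) small_cat_scheme \<Rightarrow> bool" where
  "category C \<longleftrightarrow>
     (\<forall>f\<in>Arr C. src C f \<in> Obj C \<and> rng C f \<in> Obj C) \<and>
     (\<forall>v\<in>Obj C. idn C v \<in> Arr C \<and> src C (idn C v) = v \<and> rng C (idn C v) = v) \<and>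
     (\<forall>f\<in>Arr C. \<forall>g\<in>Arr C. src C f = rng C g \<longrightarrow>
        cmp C f g \<in> Arr C \<and> src C (cmp C f g) = src C g \<and> rng C (cmp C f g) = rng C f) \<and>
     (\<forall>f\<in>Arr C. cmp C (idn C (rng C f)) f = f \<and> cmp C f (idn C (src C f)) = f) \<and>
     (\<forall>f\<in>Arr C. \<forall>g\<in>Arr C. \<forall>h\<in>Arr C. src C f = rng C g \<longrightarrow> src C g = rng C h \<longrightarrow>
        cmp C (cmp C f g) h = cmp C f (cmp C g h))"

definition groupoid :: "('v, 'e, 'z) small_cat_scheme \<Rightarrow> bool" where
  "groupoid G \<longleftrightarrow> category G \<and>
     (\<forall>a\<in>Arr G. \<exists>b\<in>Arr G. src G b = rng G a \<and> rng G b = src G a \<and>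
        cmp G a b = idn G (rng G a) \<and> cmp G b a = idn G (src G a))"

definition connected_cat :: "('v, 'e, 'z) small_cat_scheme \<Rightarrow> bool" where
  "connected_cat C \<longleftrightarrow>
     (\<forall>u\<in>Obj C. \<forall>v\<in>Obj C. equivclp (\<lambda>u v. \<exists>f\<in>Arr C. rng C f = u \<and> src C f = v) u v)"

text \<open>Functors are a pair of maps, extensional on objects and on arrows, so that HOL equality of
  functors is equality of functors.\<close>

record ('v, 'e, 'w, 'f) fmap =
  obm :: "'v \<Rightarrow> 'w"
  arm :: "'e \<Rightarrow> 'f"

definition cat_functor ::
  "('v, 'e, 'y) small_cat_scheme \<Rightarrow> ('w, 'f, 'z) small_cat_scheme \<Rightarrow> ('v, 'e, 'w, 'f) fmap \<Rightarrow> bool"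
  where
  "cat_functor C D F \<longleftrightarrow>
     obm F \<in> Obj C \<rightarrow>\<^sub>E Obj D \<and> arm F \<in> Arr C \<rightarrow>\<^sub>E Arr D \<and>
     (\<forall>f\<in>Arr C. src D (arm F f) = obm F (src C f) \<and> rng D (arm F f) = obm F (rng C f)) \<and>
     (\<forall>v\<in>Obj C. arm F (idn C v) = idn D (obm F v)) \<and>
     (\<forall>f\<in>Arr C. \<forall>g\<in>Arr C. src C f = rng C g \<longrightarrow>
        arm F (cmp C f g) = cmp D (arm F f) (arm F g))"

definition functor_id :: "('v, 'e, 'z) small_cat_scheme \<Rightarrow> ('v, 'e, 'v, 'e) fmap" where
  "functor_id C = \<lparr>obm = (\<lambda>v\<in>Obj C. v), arm = (\<lambda>f\<in>Arr C. f)\<rparr>"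

text \<open>\<open>functor_comp C F G\<close> is \<open>F \<circ> G\<close>, where \<open>C\<close> is the domain of \<open>G\<close>.\<close>

definition functor_comp ::
  "('v, 'e, 'z) small_cat_scheme \<Rightarrow> ('w, 'f, 'u, 'd) fmap \<Rightarrow> ('v, 'e, 'w, 'f) fmap
     \<Rightarrow> ('v, 'e, 'u, 'd) fmap" where
  "functor_comp C F G = \<lparr>obm = compose (Obj C) (obm F) (obm G), arm = compose (Arr C) (arm F) (arm G)\<rparr>"


section \<open>\<open>k\<close>-graphs and coverings\<close>

text \<open>\<open>\<nat>\<^sup>k\<close>, for \<open>k\<close> an arbitrary natural number (zero included).\<close>

definition Nk :: "nat \<Rightarrow> (nat \<Rightarrow> nat) set" where
  "Nk k = {n. \<forall>j\<ge>k. n j = 0}"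

record ('v, 'e) graded_cat = "('v, 'e) small_cat" +
  degr :: "'e \<Rightarrow> nat \<Rightarrow> nat"

definition kgraph :: "nat \<Rightarrow> ('v, 'e, 'z) graded_cat_scheme \<Rightarrow> bool" where
  "kgraph k L \<longleftrightarrow> category L \<and>
     (\<forall>f\<in>Arr L. degr L f \<in> Nk k) \<and>
     (\<forall>v\<in>Obj L. degr L (idn L v) = 0) \<and>
     (\<forall>f\<in>Arr L. \<forall>g\<in>Arr L. src L f = rng L g \<longrightarrow> degr L (cmp L f g) = degr L f + degr L g) \<and>
     (\<forall>f\<in>Arr L. \<forall>n\<in>Nk k. \<forall>l\<in>Nk k. degr L f = n + l \<longrightarrow>
        (\<exists>!(g, h). g \<in> Arr L \<and> h \<in> Arr L \<and> src L g = rng L h \<and>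
           degr L g = n \<and> degr L h = l \<and> f = cmp L g h))"

definition kgraph_morphism ::
  "('v, 'e, 'y) graded_cat_scheme \<Rightarrow> ('w, 'f, 'z) graded_cat_scheme \<Rightarrow> ('v, 'e, 'w, 'f) fmap \<Rightarrow> bool"
  where
  "kgraph_morphism L M F \<longleftrightarrow>
     cat_functor L M F \<and> (\<forall>f\<in>Arr L. degr M (arm F f) = degr L f)"

definition covering ::
  "nat \<Rightarrow> ('w, 'f, 'y) graded_cat_scheme \<Rightarrow> ('v, 'e, 'z) graded_cat_scheme
     \<Rightarrow> ('w, 'f, 'v, 'e) fmap \<Rightarrow> bool" where
  "covering k Om L p \<longleftrightarrow>
     kgraph k Om \<and> kgraph k L \<and> kgraph_morphism Om L p \<and>
     obm p ` Obj Om = Obj L \<and> arm p ` Arr Om = Arr L \<and>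
     (\<forall>v\<in>Obj Om.
        bij_betw (arm p) {f \<in> Arr Om. src Om f = v} {f \<in> Arr L. src L f = obm p v} \<and>
        bij_betw (arm p) {f \<in> Arr Om. rng Om f = v} {f \<in> Arr L. rng L f = obm p v})"

definition kgraph_automorphism ::
  "('v, 'e, 'z) graded_cat_scheme \<Rightarrow> ('v, 'e, 'v, 'e) fmap \<Rightarrow> bool" where
  "kgraph_automorphism L F \<longleftrightarrow> kgraph_morphism L L F \<and>
     (\<exists>F'. kgraph_morphism L L F' \<and> functor_comp L F F' = functor_id L \<and> functor_comp L F' F = functor_id L)"

definition Aut_cov ::
  "('w, 'f, 'z) graded_cat_scheme \<Rightarrow> ('w, 'f, 'v, 'e) fmap \<Rightarrow> ('w, 'f, 'w, 'f) fmap monoid" where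
  "Aut_cov Om p =
     \<lparr>carrier = {F. kgraph_automorphism Om F \<and> functor_comp Om p F = p}, mult = functor_comp Om, one = functor_id Om\<rparr>"


section \<open>The fundamental groupoid\<close>

text \<open>
  HOL cannot quantify over all types inside a definition, so the universal property has to be
  tested on groupoids whose objects and arrows live in fixed types.  The types used below
  (the term type \<open>gterm\<close> presents the groupoid generated by the arrows) are large enough:
  \<open>fundamental_groupoid_universal\<close> derives the universal property for groupoids over arbitrary
  types, and \<open>fundamental_groupoid_exists\<close> shows that every category has a fundamental groupoid.
\<close>

datatype ('v, 'e) gterm =
    Unit 'v | Gen 'e | Prod "('v, 'e) gterm" "('v, 'e) gterm" | Inv "('v, 'e) gterm"

definition fundamental_groupoid ::
  "('v, 'e, 'z) small_cat_scheme \<Rightarrow> ('v, 'g) small_cat \<Rightarrow> ('v, 'e, 'v, 'g) fmap \<Rightarrow> bool" where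
  "fundamental_groupoid L G i \<longleftrightarrow>
     groupoid G \<and> Obj G = Obj L \<and> cat_functor L G i \<and> (\<forall>v\<in>Obj L. obm i v = v) \<and>
     (\<forall>(H :: ('v, 'g + ('v, 'e) gterm set) small_cat) F. groupoid H \<and> cat_functor L H F \<longrightarrow>
        (\<exists>!F'. cat_functor G H F' \<and> functor_comp L F' i = F))"

lemma category_simps:
  assumes "category C"
  shows "f \<in> Arr C \<Longrightarrow> src C f \<in> Obj C" "f \<in> Arr C \<Longrightarrow> rng C f \<in> Obj C"
    "v \<in> Obj C \<Longrightarrow> idn C v \<in> Arr C" "v \<in> Obj C \<Longrightarrow> src C (idn C v) = v"
    "v \<in> Obj C \<Longrightarrow> rng C (idn C v) = v"
    "\<lbrakk>f \<in> Arr C; g \<in> Arr C; src C f = rng C g\<rbrakk> \<Longrightarrow> cmp C f g \<in> Arr C"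
    "\<lbrakk>f \<in> Arr C; g \<in> Arr C; src C f = rng C g\<rbrakk> \<Longrightarrow> src C (cmp C f g) = src C g"
    "\<lbrakk>f \<in> Arr C; g \<in> Arr C; src C f = rng C g\<rbrakk> \<Longrightarrow> rng C (cmp C f g) = rng C f"
    "f \<in> Arr C \<Longrightarrow> cmp C (idn C (rng C f)) f = f" "f \<in> Arr C \<Longrightarrow> cmp C f (idn C (src C f)) = f"
    "\<lbrakk>f \<in> Arr C; g \<in> Arr C; h \<in> Arr C; src C f = rng C g; src C g = rng C h\<rbrakk> \<Longrightarrow>
      cmp C (cmp C f g) h = cmp C f (cmp C g h)"
  using assms unfolding category_def by blast+

lemma cat_functor_simps:
  assumes "cat_functor C D F"
  shows "v \<in> Obj C \<Longrightarrow> obm F v \<in> Obj D" "f \<in> Arr C \<Longrightarrow> arm F f \<in> Arr D"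
    "f \<in> Arr C \<Longrightarrow> src D (arm F f) = obm F (src C f)"
    "f \<in> Arr C \<Longrightarrow> rng D (arm F f) = obm F (rng C f)"
    "v \<in> Obj C \<Longrightarrow> arm F (idn C v) = idn D (obm F v)"
    "\<lbrakk>f \<in> Arr C; g \<in> Arr C; src C f = rng C g\<rbrakk> \<Longrightarrow> arm F (cmp C f g) = cmp D (arm F f) (arm F g)"
  using assms unfolding cat_functor_def by blast+

lemma cat_functor_functor_comp:
  assumes C: "category C" and F: "cat_functor C D F" and K: "cat_functor D E K"
  shows "cat_functor C E (functor_comp C K F)"
proof -
  have "arm K (arm F (cmp C f g)) = cmp E (arm K (arm F f)) (arm K (arm F g))"
    if "f \<in> Arr C" "g \<in> Arr C" "src C f = rng C g" for f g
    using that by (simp add: cat_functor_simps[OF F] cat_functor_simps[OF K])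
  moreover have "cmp C f g \<in> Arr C" if "f \<in> Arr C" "g \<in> Arr C" "src C f = rng C g" for f g
    using that category_simps(6)[OF C] by blast
  ultimately show ?thesis
    unfolding cat_functor_def[of C E] functor_comp_def compose_def
    by (auto simp: cat_functor_simps[OF F] cat_functor_simps[OF K] category_simps[OF C])
qed

lemma functor_comp_assoc:
  assumes F: "cat_functor C D F"
  shows "functor_comp C (functor_comp D K M) F = functor_comp C K (functor_comp C M F)"
  unfolding functor_comp_def compose_def
  by (auto simp: cat_functor_simps[OF F] intro!: restrict_ext)

lemma fmap_eqI:
  assumes "cat_functor C D F" "cat_functor C D K"
    and "\<And>v. v \<in> Obj C \<Longrightarrow> obm F v = obm K v" "\<And>f. f \<in> Arr C \<Longrightarrow> arm F f = arm K f"
  shows "F = K"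
proof -
  have "obm F = obm K" "arm F = arm K"
    using assms unfolding cat_functor_def by (auto intro: PiE_ext)
  then show ?thesis by (metis fmap.equality old.unit.exhaust)
qed

lemma functor_comp_functor_id:
  assumes "cat_functor C D F"
  shows "functor_comp C F (functor_id C) = F" "functor_comp C (functor_id D) F = F"
  by (cases F; use assms in \<open>auto simp: functor_comp_def functor_id_def compose_def cat_functor_def PiE_iff
      fun_eq_iff extensional_def\<close>)+

lemma cat_functor_functor_id: "category C \<Longrightarrow> cat_functor C C (functor_id C)"
  unfolding category_def cat_functor_def functor_id_def by (auto simp: PiE_iff)

text \<open>Relabelling the arrows of a groupoid, to move it into another type.\<close>

definition relabel :: "('g \<Rightarrow> 'h) \<Rightarrow> ('v, 'g) small_cat \<Rightarrow> ('v, 'h) small_cat" where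
  "relabel r G = \<lparr>Obj = Obj G, Arr = r ` Arr G, src = src G \<circ> inv_into UNIV r,
     rng = rng G \<circ> inv_into UNIV r, idn = r \<circ> idn G,
     cmp = (\<lambda>a b. r (cmp G (inv_into UNIV r a) (inv_into UNIV r b)))\<rparr>"

definition relabel_fun :: "('g \<Rightarrow> 'h) \<Rightarrow> ('v, 'g) small_cat \<Rightarrow> ('v, 'g, 'v, 'h) fmap" where
  "relabel_fun r G = \<lparr>obm = (\<lambda>v\<in>Obj G. v), arm = (\<lambda>a\<in>Arr G. r a)\<rparr>"

definition unlabel_fun :: "('g \<Rightarrow> 'h) \<Rightarrow> ('v, 'g) small_cat \<Rightarrow> ('v, 'h, 'v, 'g) fmap" where
  "unlabel_fun r G = \<lparr>obm = (\<lambda>v\<in>Obj G. v), arm = (\<lambda>a\<in>r ` Arr G. inv_into UNIV r a)\<rparr>"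

lemma relabel:
  assumes "inj r" "groupoid G"
  shows "groupoid (relabel r G)" "cat_functor G (relabel r G) (relabel_fun r G)"
    "cat_functor (relabel r G) G (unlabel_fun r G)"
    "functor_comp G (unlabel_fun r G) (relabel_fun r G) = functor_id G"
proof -
  note d = relabel_def relabel_fun_def unlabel_fun_def
  show "groupoid (relabel r G)"
    using assms(2) unfolding groupoid_def category_def d by (simp add: inv_f_f[OF assms(1)]) metis
  show "cat_functor G (relabel r G) (relabel_fun r G)"
    using assms(2) unfolding groupoid_def category_def d cat_functor_def
    by (auto simp: inv_f_f[OF assms(1)] PiE_iff)
  show "cat_functor (relabel r G) G (unlabel_fun r G)"
    using assms(2) unfolding groupoid_def category_def d cat_functor_def
    by (auto simp: inv_f_f[OF assms(1)] PiE_iff)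
  show "functor_comp G (unlabel_fun r G) (relabel_fun r G) = functor_id G"
    unfolding d functor_comp_def functor_id_def by (auto simp: inv_f_f[OF assms(1)] compose_def fun_eq_iff)
qed

text \<open>The groupoid of terms: \<open>tends L t\<close> is the pair of range and source of the term \<open>t\<close>.\<close>

primrec tends :: "('v, 'e, 'z) small_cat_scheme \<Rightarrow> ('v, 'e) gterm \<Rightarrow> 'v \<times> 'v" where
  "tends L (Unit v) = (v, v)"
| "tends L (Gen f) = (rng L f, src L f)"
| "tends L (Prod s t) = (fst (tends L s), snd (tends L t))"
| "tends L (Inv t) = (snd (tends L t), fst (tends L t))"

primrec wt :: "('v, 'e, 'z) small_cat_scheme \<Rightarrow> ('v, 'e) gterm \<Rightarrow> bool" where
  "wt L (Unit v) \<longleftrightarrow> v \<in> Obj L"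
| "wt L (Gen f) \<longleftrightarrow> f \<in> Arr L"
| "wt L (Prod s t) \<longleftrightarrow> wt L s \<and> wt L t \<and> snd (tends L s) = fst (tends L t)"
| "wt L (Inv t) \<longleftrightarrow> wt L t"

inductive teq :: "('v, 'e, 'z) small_cat_scheme \<Rightarrow> ('v, 'e) gterm \<Rightarrow> ('v, 'e) gterm \<Rightarrow> bool"
  for L where
  refl: "wt L t \<Longrightarrow> teq L t t"
| sym: "teq L s t \<Longrightarrow> teq L t s"
| trans: "teq L s t \<Longrightarrow> teq L t u \<Longrightarrow> teq L s u"
| prod: "teq L s s' \<Longrightarrow> teq L t t' \<Longrightarrow> snd (tends L s) = fst (tends L t) \<Longrightarrow>
    teq L (Prod s t) (Prod s' t')"
| inv: "teq L s t \<Longrightarrow> teq L (Inv s) (Inv t)"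
| assoc: "wt L (Prod (Prod s t) u) \<Longrightarrow> teq L (Prod (Prod s t) u) (Prod s (Prod t u))"
| unitl: "wt L t \<Longrightarrow> teq L (Prod (Unit (fst (tends L t))) t) t"
| unitr: "wt L t \<Longrightarrow> teq L (Prod t (Unit (snd (tends L t)))) t"
| invl: "wt L t \<Longrightarrow> teq L (Prod (Inv t) t) (Unit (snd (tends L t)))"
| invr: "wt L t \<Longrightarrow> teq L (Prod t (Inv t)) (Unit (fst (tends L t)))"
| gen_idn: "v \<in> Obj L \<Longrightarrow> teq L (Gen (idn L v)) (Unit v)"
| gen_cmp: "f \<in> Arr L \<Longrightarrow> g \<in> Arr L \<Longrightarrow> src L f = rng L g \<Longrightarrow>
    teq L (Gen (cmp L f g)) (Prod (Gen f) (Gen g))"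

definition tcls :: "('v, 'e, 'z) small_cat_scheme \<Rightarrow> ('v, 'e) gterm \<Rightarrow> ('v, 'e) gterm set" where
  "tcls L t = {s. teq L t s}"

definition trep :: "('v, 'e) gterm set \<Rightarrow> ('v, 'e) gterm" where
  "trep A = (SOME t. t \<in> A)"

definition term_groupoid ::
  "('v, 'e, 'z) small_cat_scheme \<Rightarrow> ('v, ('v, 'e) gterm set) small_cat" where
  "term_groupoid L = \<lparr>Obj = Obj L, Arr = tcls L ` {t. wt L t}, src = (\<lambda>A. snd (tends L (trep A))),
     rng = (\<lambda>A. fst (tends L (trep A))), idn = (\<lambda>v. tcls L (Unit v)),
     cmp = (\<lambda>A B. tcls L (Prod (trep A) (trep B)))\<rparr>"

definition term_fun ::
  "('v, 'e, 'z) small_cat_scheme \<Rightarrow> ('v, 'e, 'v, ('v, 'e) gterm set) fmap" where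
  "term_fun L = \<lparr>obm = (\<lambda>v\<in>Obj L. v), arm = (\<lambda>f\<in>Arr L. tcls L (Gen f))\<rparr>"

lemma tends_Obj: "category L \<Longrightarrow> wt L t \<Longrightarrow> fst (tends L t) \<in> Obj L \<and> snd (tends L t) \<in> Obj L"
  by (induction t) (auto simp: category_simps)

lemma teq_wt:
  assumes "teq L s t" "category L"
  shows "wt L s \<and> wt L t \<and> tends L s = tends L t"
  using assms by (induction) (auto simp: category_simps tends_Obj)

lemma tcls_eq:
  assumes "category L" "teq L s t"
  shows "tcls L s = tcls L t"
  using assms unfolding tcls_def by (blast intro: teq.sym teq.trans)

lemma teq_trep:
  assumes "wt L t"
  shows "teq L (trep (tcls L t)) t"
proof -
  have "t \<in> tcls L t" using assms by (simp add: tcls_def teq.refl)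
  then have "trep (tcls L t) \<in> tcls L t" unfolding trep_def by (rule someI)
  then show ?thesis by (simp add: tcls_def teq.sym)
qed

lemma term_groupoid_simps:
  assumes "category L"
  shows "Obj (term_groupoid L) = Obj L" "Arr (term_groupoid L) = tcls L ` {t. wt L t}"
    "idn (term_groupoid L) v = tcls L (Unit v)"
    "wt L t \<Longrightarrow> src (term_groupoid L) (tcls L t) = snd (tends L t)"
    "wt L t \<Longrightarrow> rng (term_groupoid L) (tcls L t) = fst (tends L t)"
    "wt L (Prod s t) \<Longrightarrow> cmp (term_groupoid L) (tcls L s) (tcls L t) = tcls L (Prod s t)"
proof -
  show "wt L t \<Longrightarrow> src (term_groupoid L) (tcls L t) = snd (tends L t)"
    "wt L t \<Longrightarrow> rng (term_groupoid L) (tcls L t) = fst (tends L t)"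
    using teq_wt[OF teq_trep assms] by (simp_all add: term_groupoid_def)
  show "cmp (term_groupoid L) (tcls L s) (tcls L t) = tcls L (Prod s t)" if "wt L (Prod s t)"
  proof -
    have "teq L (Prod (trep (tcls L s)) (trep (tcls L t))) (Prod s t)"
      using that teq_wt[OF teq_trep assms] by (intro teq.prod teq_trep) auto
    then show ?thesis by (simp add: term_groupoid_def tcls_eq assms)
  qed
qed (simp_all add: term_groupoid_def)

lemma groupoid_term_groupoid:
  assumes "category L"
  shows "groupoid (term_groupoid L)"
proof -
  note s = term_groupoid_simps[OF assms] tends_Obj[OF assms]
  have c: "category (term_groupoid L)"
    unfolding category_def
    by (auto simp: s intro!: tcls_eq[OF assms] teq.unitl teq.unitr teq.assoc)
  moreover have "\<exists>b\<in>Arr (term_groupoid L). src (term_groupoid L) b = rng (term_groupoid L) a \<and>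
      rng (term_groupoid L) b = src (term_groupoid L) a \<and>
      cmp (term_groupoid L) a b = idn (term_groupoid L) (rng (term_groupoid L) a) \<and>
      cmp (term_groupoid L) b a = idn (term_groupoid L) (src (term_groupoid L) a)"
    if a: "a \<in> Arr (term_groupoid L)" for a
  proof -
    obtain t where t: "wt L t" "a = tcls L t" using a by (auto simp: s)
    show ?thesis
      by (rule bexI[of _ "tcls L (Inv t)"])
        (use t in \<open>auto simp: s intro!: tcls_eq[OF assms] teq.invl teq.invr\<close>)
  qed
  ultimately show ?thesis unfolding groupoid_def by blast
qed

lemma cat_functor_term_fun:
  assumes "category L"
  shows "cat_functor L (term_groupoid L) (term_fun L)"
  using assms
  by (auto simp: cat_functor_def term_fun_def term_groupoid_simps PiE_iff category_simps
      intro!: tcls_eq[OF assms] teq.gen_idn teq.gen_cmp)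

definition is_ginv :: "('v, 'g, 'z) small_cat_scheme \<Rightarrow> 'g \<Rightarrow> 'g \<Rightarrow> bool" where
  "is_ginv G a b \<longleftrightarrow> b \<in> Arr G \<and> src G b = rng G a \<and> rng G b = src G a \<and>
     cmp G a b = idn G (rng G a) \<and> cmp G b a = idn G (src G a)"

definition ginv :: "('v, 'g, 'z) small_cat_scheme \<Rightarrow> 'g \<Rightarrow> 'g" where
  "ginv G a = (SOME b. is_ginv G a b)"

lemma is_ginv_ginv: "groupoid G \<Longrightarrow> a \<in> Arr G \<Longrightarrow> is_ginv G a (ginv G a)"
  unfolding ginv_def by (rule someI_ex) (auto simp: groupoid_def is_ginv_def)

lemma is_ginv_unique:
  assumes "category G" "a \<in> Arr G" "is_ginv G a b" "is_ginv G a c"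
  shows "b = c"
proof -
  have "b = cmp G b (cmp G a c)"
    using assms category_simps[OF assms(1)] unfolding is_ginv_def by metis
  also have "\<dots> = cmp G (cmp G b a) c"
    using assms category_simps(11)[OF assms(1)] unfolding is_ginv_def by metis
  also have "\<dots> = c"
    using assms category_simps[OF assms(1)] unfolding is_ginv_def by metis
  finally show ?thesis .
qed

primrec teval ::
  "('w, 'h, 'z) small_cat_scheme \<Rightarrow> ('v, 'e, 'w, 'h) fmap \<Rightarrow> ('v, 'e) gterm \<Rightarrow> 'h" where
  "teval H F (Unit v) = idn H (obm F v)"
| "teval H F (Gen f) = arm F f"
| "teval H F (Prod s t) = cmp H (teval H F s) (teval H F t)"
| "teval H F (Inv t) = ginv H (teval H F t)"

lemma teval_wt:
  assumes "groupoid H" "cat_functor L H F" "wt L t"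
  shows "teval H F t \<in> Arr H \<and> src H (teval H F t) = obm F (snd (tends L t)) \<and>
    rng H (teval H F t) = obm F (fst (tends L t))"
proof -
  have c: "category H" using assms(1) by (simp add: groupoid_def)
  show ?thesis
    using assms(3) is_ginv_ginv[OF assms(1)]
    by (induction t) (auto simp: category_simps[OF c] cat_functor_simps[OF assms(2)] is_ginv_def)
qed

lemma teval_teq:
  assumes "category L" "groupoid H" "cat_functor L H F" "teq L s t"
  shows "teval H F s = teval H F t"
proof -
  have c: "category H" using assms(2) by (simp add: groupoid_def)
  note e = teval_wt[OF assms(2,3)]
  note i = is_ginv_ginv[OF assms(2), unfolded is_ginv_def]
  show ?thesis
    using assms(4)
  proof induction
    case (assoc s t u)
    then show ?case
      by (simp add: category_simps(11)[OF c] e)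
  next
    case (unitl t)
    then show ?case using category_simps(9)[OF c] e[OF unitl] by (metis teval.simps(1,3))
  next
    case (unitr t)
    then show ?case using category_simps(10)[OF c] e[OF unitr] by (metis teval.simps(1,3))
  next
    case (invl t)
    then show ?case using i e[OF invl] by (metis teval.simps(1,3,4))
  next
    case (invr t)
    then show ?case using i e[OF invr] by (metis teval.simps(1,3,4))
  qed (auto simp: cat_functor_simps[OF assms(3)])
qed

lemma term_groupoid_universal:
  assumes L: "category L" and H: "groupoid H" and F: "cat_functor L H F"
  shows "\<exists>!F'. cat_functor (term_groupoid L) H F' \<and> functor_comp L F' (term_fun L) = F"
proof (rule ex_ex1I)
  note s = term_groupoid_simps[OF L]
  note e = teval_wt[OF H F]
  have c: "category H" using H by (simp add: groupoid_def)
  have r: "teval H F (trep (tcls L t)) = teval H F t" if "wt L t" for t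
    by (rule teval_teq[OF L H F teq_trep[OF that]])
  define F' where "F' = \<lparr>obm = (\<lambda>v\<in>Obj L. obm F v),
     arm = (\<lambda>A\<in>Arr (term_groupoid L). teval H F (trep A))\<rparr>"
  have 1: "cat_functor (term_groupoid L) H F'"
    unfolding cat_functor_def F'_def
    by (auto simp: s r e tends_Obj[OF L] cat_functor_simps[OF F])
  have 2: "functor_comp L F' (term_fun L) = F"
  proof (rule fmap_eqI[OF _ F])
    show "cat_functor L H (functor_comp L F' (term_fun L))"
      by (rule cat_functor_functor_comp[OF L cat_functor_term_fun[OF L] 1])
  qed (auto simp: functor_comp_def compose_def F'_def term_fun_def s r)
  show "\<exists>F'. cat_functor (term_groupoid L) H F' \<and> functor_comp L F' (term_fun L) = F"
    using 1 2 by blast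
  fix A B
  assume A: "cat_functor (term_groupoid L) H A \<and> functor_comp L A (term_fun L) = F"
    and B: "cat_functor (term_groupoid L) H B \<and> functor_comp L B (term_fun L) = F"
  have o: "obm K v = obm F v" if "v \<in> Obj L" "functor_comp L K (term_fun L) = F" for K v
    using that by (auto simp: functor_comp_def compose_def term_fun_def)
  have "arm K (tcls L t) = teval H F t"
    if K: "cat_functor (term_groupoid L) H K" "functor_comp L K (term_fun L) = F" and "wt L t" for K t
    using that(3)
  proof (induction t)
    case (Unit v)
    then show ?case using cat_functor_simps(5)[OF K(1), of v] o[OF _ K(2)] by (simp add: s)
  next
    case (Gen f)
    then show ?case using K(2) by (auto simp: functor_comp_def compose_def term_fun_def)
  next
    case (Prod t u)
    then show ?case using cat_functor_simps(6)[OF K(1), of "tcls L t" "tcls L u"] by (simp add: s)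
  next
    case (Inv t)
    let ?T = "term_groupoid L"
    from Inv have t: "wt L t" "arm K (tcls L t) = teval H F t" by auto
    have a: "tcls L t \<in> Arr (term_groupoid L)" "tcls L (Inv t) \<in> Arr (term_groupoid L)"
      using t by (auto simp: s)
    have m: "cmp (term_groupoid L) (tcls L t) (tcls L (Inv t)) = idn (term_groupoid L) (fst (tends L t))"
      "cmp (term_groupoid L) (tcls L (Inv t)) (tcls L t) = idn (term_groupoid L) (snd (tends L t))"
      using t by (auto simp: s intro!: tcls_eq[OF L] teq.invl teq.invr)
    have ends: "src ?T (tcls L t) = snd (tends L t)" "rng ?T (tcls L t) = fst (tends L t)"
      "src ?T (tcls L (Inv t)) = fst (tends L t)" "rng ?T (tcls L (Inv t)) = snd (tends L t)"
      using t by (simp_all add: s)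
    have ob: "fst (tends L t) \<in> Obj ?T" "snd (tends L t) \<in> Obj ?T"
      using tends_Obj[OF L t(1)] by (simp_all add: s)
    have "is_ginv H (arm K (tcls L t)) (arm K (tcls L (Inv t)))"
      unfolding is_ginv_def
      using cat_functor_simps(6)[OF K(1) a(1) a(2)] cat_functor_simps(6)[OF K(1) a(2) a(1)]
      by (simp add: a ends m cat_functor_simps(2-4)[OF K(1)] cat_functor_simps(5)[OF K(1), OF ob(1)]
          cat_functor_simps(5)[OF K(1), OF ob(2)])
    then have "is_ginv H (teval H F t) (arm K (tcls L (Inv t)))" by (simp only: t(2))
    moreover have "is_ginv H (teval H F t) (ginv H (teval H F t))"
      using is_ginv_ginv[OF H] e[OF t(1)] by blast
    ultimately show ?case using is_ginv_unique[OF c] e[OF t(1)] by auto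
  qed
  then show "A = B"
    by (intro fmap_eqI[of "term_groupoid L" H]) (use A B o in \<open>auto simp: s\<close>)
qed

theorem fundamental_groupoid_exists:
  assumes "category L"
  shows "fundamental_groupoid L (term_groupoid L) (term_fun L)"
proof -
  have "obm (term_fun L) v = v" if "v \<in> Obj L" for v using that by (simp add: term_fun_def)
  then show ?thesis
    unfolding fundamental_groupoid_def
    using groupoid_term_groupoid[OF assms] cat_functor_term_fun[OF assms]
      term_groupoid_simps(1)[OF assms] term_groupoid_universal[OF assms]
    by blast
qed

theorem fundamental_groupoid_universal:
  fixes L :: "('v, 'e, 'z) small_cat_scheme" and G :: "('v, 'g) small_cat"
    and H :: "('w, 'h, 'y) small_cat_scheme"
  assumes L: "category L" and G: "fundamental_groupoid L G i"
    and H: "groupoid H" and F: "cat_functor L H F"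
  shows "\<exists>!F'. cat_functor G H F' \<and> functor_comp L F' i = F"
proof -
  let ?T = "term_groupoid L" and ?j = "term_fun L"
  let ?r = "Inr :: _ \<Rightarrow> 'g + ('v, 'e) gterm set" and ?l = "Inl :: _ \<Rightarrow> 'g + ('v, 'e) gterm set"
  have gG: "groupoid G" and i: "cat_functor L G i"
    and univ: "\<And>(K :: ('v, 'g + ('v, 'e) gterm set) small_cat) F. groupoid K \<Longrightarrow>
      cat_functor L K F \<Longrightarrow> \<exists>!F'. cat_functor G K F' \<and> functor_comp L F' i = F"
    using G unfolding fundamental_groupoid_def by blast+
  have cG: "category G" using gG by (simp add: groupoid_def)
  have cT: "category ?T" using groupoid_term_groupoid[OF L] by (simp add: groupoid_def)
  note gT = groupoid_term_groupoid[OF L] and j = cat_functor_term_fun[OF L]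
  note rr = relabel[where r = ?r, OF inj_Inr gT]
  note ll = relabel[where r = ?l, OF inj_Inl gG]
  obtain P where P: "cat_functor G (relabel ?r ?T) P" "functor_comp L P i = functor_comp L (relabel_fun ?r ?T) ?j"
    using univ[OF rr(1) cat_functor_functor_comp[OF L j rr(2)]] by blast
  define Q where "Q = functor_comp G (unlabel_fun ?r ?T) P"
  have Q: "cat_functor G ?T Q" unfolding Q_def by (rule cat_functor_functor_comp[OF cG P(1) rr(3)])
  have Qi: "functor_comp L Q i = ?j"
    unfolding Q_def functor_comp_assoc[OF i] P(2)
    by (simp add: functor_comp_assoc[OF j, symmetric] rr(4) functor_comp_functor_id[OF j])
  obtain R where R: "cat_functor ?T G R" "functor_comp L R ?j = i"
    using term_groupoid_universal[OF L gG i] by blast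
  have RQ: "cat_functor G G (functor_comp G R Q)" by (rule cat_functor_functor_comp[OF cG Q R(1)])
  have "functor_comp L (functor_comp G (relabel_fun ?l G) (functor_comp G R Q)) i = functor_comp L (relabel_fun ?l G) i"
    by (simp add: functor_comp_assoc[OF i] Qi R(2))
  then have "functor_comp G (relabel_fun ?l G) (functor_comp G R Q) = relabel_fun ?l G"
    using univ[OF ll(1) cat_functor_functor_comp[OF L i ll(2)]] ll(2) cat_functor_functor_comp[OF cG RQ ll(2)] by blast
  then have "functor_comp G (functor_comp G (unlabel_fun ?l G) (relabel_fun ?l G)) (functor_comp G R Q) = functor_id G"
    by (subst functor_comp_assoc[OF RQ]) (simp add: ll(4))
  then have RQ1: "functor_comp G R Q = functor_id G" by (simp add: ll(4) functor_comp_functor_id[OF RQ])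
  show ?thesis
  proof (rule ex_ex1I)
    obtain F0 where F0: "cat_functor ?T H F0" "functor_comp L F0 ?j = F"
      using term_groupoid_universal[OF L H F] by blast
    have "functor_comp L (functor_comp G F0 Q) i = F" by (simp add: functor_comp_assoc[OF i] Qi F0)
    then show "\<exists>F'. cat_functor G H F' \<and> functor_comp L F' i = F"
      using cat_functor_functor_comp[OF cG Q F0(1)] by blast
  next
    fix A B
    assume A: "cat_functor G H A \<and> functor_comp L A i = F" and B: "cat_functor G H B \<and> functor_comp L B i = F"
    have "functor_comp L (functor_comp ?T A R) ?j = F" "functor_comp L (functor_comp ?T B R) ?j = F"
      using A B by (simp_all add: functor_comp_assoc[OF j] R)
    then have e: "functor_comp ?T A R = functor_comp ?T B R"
      using term_groupoid_universal[OF L H F] A B cat_functor_functor_comp[OF cT R(1)] by blast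
    have "A = functor_comp G (functor_comp ?T A R) Q" "B = functor_comp G (functor_comp ?T B R) Q"
      using A B by (simp_all add: functor_comp_assoc[OF Q] RQ1 functor_comp_functor_id(1)[of _ H])
    then show "A = B" using e by simp
  qed
qed

text \<open>The functor \<open>p\<^sub>*\<close> between fundamental groupoids induced by a functor \<open>p\<close> from \<open>L\<close> to \<open>M\<close>;
  \<open>i\<close> and \<open>j\<close> are the canonical functors from \<open>L\<close> to \<open>GL\<close> and from \<open>M\<close> to \<open>GM\<close>.\<close>

definition induced_functor ::
  "('w, 'f, 'y) small_cat_scheme \<Rightarrow> ('w, 'h) small_cat \<Rightarrow> ('w, 'f, 'w, 'h) fmap
     \<Rightarrow> ('v, 'g) small_cat \<Rightarrow> ('v, 'e, 'v, 'g) fmap \<Rightarrow> ('w, 'f, 'v, 'e) fmap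
     \<Rightarrow> ('w, 'h, 'v, 'g) fmap" where
  "induced_functor L GL i GM j p =
     (THE P. cat_functor GL GM P \<and> functor_comp L P i = functor_comp L j p)"

definition isotropy_group :: "('v, 'g) small_cat \<Rightarrow> 'v \<Rightarrow> 'g monoid" where
  "isotropy_group G x =
     \<lparr>carrier = {a \<in> Arr G. rng G a = x \<and> src G a = x}, mult = cmp G, one = idn G x\<rparr>"


section \<open>The actions of the fundamental groupoid and of the normalizer\<close>

definition fibre :: "('w, 'f, 'z) small_cat_scheme \<Rightarrow> ('w, 'f, 'v, 'e) fmap \<Rightarrow> 'v \<Rightarrow> 'w set" where
  "fibre Om p x = {u \<in> Obj Om. obm p u = x}"

text \<open>The action of the fundamental groupoid \<open>(G, i)\<close> of the base on the vertices of the covering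
  space, with value \<open>undefined\<close> at \<open>a\<close> and \<open>u\<close> unless \<open>a \<in> Arr G\<close> and \<open>obm p u = src G a\<close>.\<close>

definition vertex_action ::
  "('w, 'f, 'z) small_cat_scheme \<Rightarrow> ('w, 'f, 'v, 'e) fmap \<Rightarrow> ('v, 'g) small_cat
     \<Rightarrow> ('v, 'e, 'v, 'g) fmap \<Rightarrow> 'g \<Rightarrow> 'w \<Rightarrow> 'w" where
  "vertex_action Om p G i = (THE A.
     A \<in> extensional (Arr G) \<and>
     (\<forall>a\<in>Arr G. A a \<in> extensional (fibre Om p (src G a)) \<and>
        bij_betw (A a) (fibre Om p (src G a)) (fibre Om p (rng G a))) \<and>
     (\<forall>y\<in>Obj G. \<forall>u\<in>fibre Om p y. A (idn G y) u = u) \<and>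
     (\<forall>a\<in>Arr G. \<forall>b\<in>Arr G. src G a = rng G b \<longrightarrow>
        (\<forall>u\<in>fibre Om p (src G b). A (cmp G a b) u = A a (A b u))) \<and>
     (\<forall>l\<in>Arr Om. A (arm i (arm p l)) (src Om l) = rng Om l))"

text \<open>\<open>connects \<dots> v l a\<close>: the arrow \<open>a\<close> of \<open>G\<close> is a possible choice in the definition of \<open>\<lambda>c\<close>,
  that is, \<open>s(\<lambda>) = av\<close>.  \<open>is_translate \<dots> v l a c m\<close>: \<open>p(m) = p(\<lambda>)\<close> and \<open>s(m) = acv\<close>.\<close>

definition connects ::
  "('w, 'f, 'z) small_cat_scheme \<Rightarrow> ('w, 'f, 'v, 'e) fmap \<Rightarrow> ('v, 'g) small_cat
     \<Rightarrow> ('v, 'e, 'v, 'g) fmap \<Rightarrow> 'w \<Rightarrow> 'f \<Rightarrow> 'g \<Rightarrow> bool" where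
  "connects Om p G i v l a \<longleftrightarrow>
     a \<in> Arr G \<and> src G a = obm p v \<and> src Om l = vertex_action Om p G i a v"

definition is_translate ::
  "('w, 'f, 'z) small_cat_scheme \<Rightarrow> ('w, 'f, 'v, 'e) fmap \<Rightarrow> ('v, 'g) small_cat
     \<Rightarrow> ('v, 'e, 'v, 'g) fmap \<Rightarrow> 'w \<Rightarrow> 'f \<Rightarrow> 'g \<Rightarrow> 'g \<Rightarrow> 'f \<Rightarrow> bool" where
  "is_translate Om p G i v l a c m \<longleftrightarrow>
     m \<in> Arr Om \<and> arm p m = arm p l \<and> src Om m = vertex_action Om p G i (cmp G a c) v"

definition right_action ::
  "('w, 'f, 'z) small_cat_scheme \<Rightarrow> ('w, 'f, 'v, 'e) fmap \<Rightarrow> ('v, 'g) small_cat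
     \<Rightarrow> ('v, 'e, 'v, 'g) fmap \<Rightarrow> 'w \<Rightarrow> 'f \<Rightarrow> 'g \<Rightarrow> 'f" where
  "right_action Om p G i v l c =
     (THE m. is_translate Om p G i v l (SOME a. connects Om p G i v l a) c m)"

text \<open>The map \<open>\<lambda> \<mapsto> \<lambda>c\<close> as a functor; on vertices it is the action on identity morphisms.\<close>

definition translation ::
  "('w, 'f, 'z) small_cat_scheme \<Rightarrow> ('w, 'f, 'v, 'e) fmap \<Rightarrow> ('v, 'g) small_cat
     \<Rightarrow> ('v, 'e, 'v, 'g) fmap \<Rightarrow> 'w \<Rightarrow> 'g \<Rightarrow> ('w, 'f, 'w, 'f) fmap" where
  "translation Om p G i v c =
     \<lparr>obm = (\<lambda>u\<in>Obj Om. src Om (right_action Om p G i v (idn Om u) c)),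
      arm = (\<lambda>l\<in>Arr Om. right_action Om p G i v l c)\<rparr>"

end

theory Submission
  imports Defs
begin

text \<open>
  Lifting arrows along \<open>p\<close> is a functor from \<open>\<Lambda>\<close> to the groupoid of bijections between the fibres, so
  it extends to an action of \<open>\<G>(\<Lambda>)\<close> on \<open>\<Omega>\<^sup>0\<close>.  As \<open>\<G>(\<Lambda>)\<close> is generated by the image of \<open>\<Lambda>\<close>, this
  action commutes with deck transformations, and \<open>p\<^sub>*\<pi>(\<Omega>, v)\<close> is the stabilizer of \<open>v\<close> in
  \<open>\<pi>(\<Lambda>, x)\<close>.  Connectedness makes the action transitive, so a deck transformation is determined
  by its value at \<open>v\<close>.  The possible values are the vertices \<open>cv\<close> with the same stabilizer as \<open>v\<close>,
  that is, with \<open>c\<close> in the normalizer; and \<open>c\<close> gives the identity if and only if \<open>cv = v\<close>.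
\<close>

section \<open>Generation of the fundamental groupoid by the arrows of the category\<close>

text \<open>The arrows satisfying \<open>Q\<close> form a subgroupoid \<open>K\<close> through which
  \<open>i\<close> factors. The universal property gives a functor from \<open>G\<close> to
  \<open>K\<close> compatible with \<open>i\<close>; followed by the inclusion into \<open>G\<close>
  it must be the identity, so \<open>K\<close> contains every arrow.\<close>

lemma fundamental_groupoid_induct [consumes 3, case_names gen cmp inv]:
  assumes L: "category L" and G: "fundamental_groupoid L G i" and a: "a \<in> Arr G"
    and gen: "\<And>f. f \<in> Arr L \<Longrightarrow> Q (arm i f)"
    and cmp: "\<And>a b. \<lbrakk>a \<in> Arr G; b \<in> Arr G; src G a = rng G b; Q a; Q b\<rbrakk> \<Longrightarrow> Q (cmp G a b)"
    and inv: "\<And>a b. \<lbrakk>a \<in> Arr G; is_ginv G a b; Q a\<rbrakk> \<Longrightarrow> Q b"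
  shows "Q a"
proof -
  have gG: "groupoid G" and OG: "Obj G = Obj L" and i: "cat_functor L G i"
    and i0: "\<And>v. v \<in> Obj L \<Longrightarrow> obm i v = v"
    using G unfolding fundamental_groupoid_def by blast+
  have cG: "category G" using gG by (simp add: groupoid_def)
  define K where "K = G\<lparr>Arr := {a \<in> Arr G. Q a}\<rparr>"
  \<comment> \<open>Units need no case of their own in the induction: a unit of \<open>G\<close> is
    the image of a unit of \<open>L\<close>.\<close>
  have idQ: "Q (idn G v)" if "v \<in> Obj G" for v
    using that gen[of "idn L v"] cat_functor_simps(5)[OF i, of v] category_simps(3)[OF L, of v]
    by (simp add: OG i0)
  have cK: "category K"
    using cG cmp idQ unfolding category_def K_def by simp
  have "\<exists>b\<in>Arr K. src K b = rng K a \<and> rng K b = src K a \<and>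
      cmp K a b = idn K (rng K a) \<and> cmp K b a = idn K (src K a)" if "a \<in> Arr K" for a
  proof (rule bexI[of _ "ginv G a"])
    have "is_ginv G a (ginv G a)" "Q a" "a \<in> Arr G"
      using that is_ginv_ginv[OF gG] by (auto simp: K_def)
    then show "ginv G a \<in> Arr K" using inv unfolding is_ginv_def K_def by auto
    show "src K (ginv G a) = rng K a \<and> rng K (ginv G a) = src K a \<and>
        cmp K a (ginv G a) = idn K (rng K a) \<and> cmp K (ginv G a) a = idn K (src K a)"
      using \<open>is_ginv G a (ginv G a)\<close> by (simp add: is_ginv_def K_def)
  qed
  then have gK: "groupoid K" using cK unfolding groupoid_def by blast
  have "cat_functor L K i"
    using i gen unfolding cat_functor_def K_def by (auto simp: PiE_iff)
  then obtain F where F: "cat_functor G K F" "functor_comp L F i = i"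
    using fundamental_groupoid_universal[OF L G gK] by blast
  \<comment> \<open>\<open>K\<close> and \<open>G\<close> share all structure maps, so
    \<open>F\<close> itself, read with codomain \<open>G\<close>, is its composite with the
    inclusion.\<close>
  have FG: "cat_functor G G F"
    using F(1) unfolding cat_functor_def K_def by (auto simp: PiE_iff)
  have "F = functor_id G"
    using fundamental_groupoid_universal[OF L G gG i] FG F(2) cat_functor_functor_id[OF cG]
      functor_comp_functor_id(2)[OF i] by blast
  then have "arm F a = a" using a by (simp add: functor_id_def)
  then show ?thesis using cat_functor_simps(2)[OF F(1) a] by (simp add: K_def)
qed

text \<open>The description in \<open>induced_functor\<close> is proper: the composite of
  \<open>p\<close> and \<open>j\<close> is a functor from \<open>L\<close> to the groupoid
  \<open>GM\<close>, hence factors uniquely through \<open>i\<close>.\<close>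

lemma induced_functor_universal:
  assumes L: "category L" and M: "category M"
    and GL: "fundamental_groupoid L GL i" and GM: "fundamental_groupoid M GM j"
    and p: "cat_functor L M p"
  shows "cat_functor GL GM (induced_functor L GL i GM j p)"
    and "functor_comp L (induced_functor L GL i GM j p) i = functor_comp L j p"
proof -
  have "groupoid GM" "cat_functor M GM j"
    using GM unfolding fundamental_groupoid_def by blast+
  then have "\<exists>!P. cat_functor GL GM P \<and> functor_comp L P i = functor_comp L j p"
    using fundamental_groupoid_universal[OF L GL] cat_functor_functor_comp[OF L p] by blast
  from theI'[OF this] show "cat_functor GL GM (induced_functor L GL i GM j p)"
    and "functor_comp L (induced_functor L GL i GM j p) i = functor_comp L j p"
    unfolding induced_functor_def by blast+
qed

section \<open>Isotropy groups and normalizers\<close>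

lemma group_isotropy_group:
  assumes G: "groupoid G" and x: "x \<in> Obj G"
  shows "group (isotropy_group G x)"
proof -
  have c: "category G" using G by (simp add: groupoid_def)
  show ?thesis
  proof (rule groupI)
    fix a assume a: "a \<in> carrier (isotropy_group G x)"
    then have "is_ginv G a (ginv G a)"
      using is_ginv_ginv[OF G] by (simp add: isotropy_group_def)
    then show "\<exists>b\<in>carrier (isotropy_group G x). b \<otimes>\<^bsub>isotropy_group G x\<^esub> a = \<one>\<^bsub>isotropy_group G x\<^esub>"
      using a by (intro bexI[of _ "ginv G a"]) (auto simp: isotropy_group_def is_ginv_def)
  next
    fix a assume "a \<in> carrier (isotropy_group G x)"
    then show "\<one>\<^bsub>isotropy_group G x\<^esub> \<otimes>\<^bsub>isotropy_group G x\<^esub> a = a"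
      using category_simps(9)[OF c, of a] by (simp add: isotropy_group_def)
  qed (use x in \<open>auto simp: isotropy_group_def category_simps[OF c]\<close>)
qed

text \<open>The library defines the normalizer as the stabilizer of \<open>H\<close> under
  conjugation of subsets. Testing the set equation on single elements gives a condition that can
  later be read in terms of fixed vertices.\<close>

lemma (in group) mem_normalizer_iff:
  assumes H: "H \<subseteq> carrier G"
  shows "c \<in> normalizer G H \<longleftrightarrow>
    c \<in> carrier G \<and> (\<forall>h\<in>carrier G. h \<in> H \<longleftrightarrow> inv c \<otimes> h \<otimes> c \<in> H)"
proof (cases "c \<in> carrier G")
  case True
  have "h \<in> c <# H #> inv c \<longleftrightarrow> inv c \<otimes> h \<otimes> c \<in> H" if "h \<in> carrier G" for h
  proof
    assume "h \<in> c <# H #> inv c"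
    then obtain t where t: "t \<in> H" "h = c \<otimes> t \<otimes> inv c"
      by (auto simp: l_coset_def r_coset_def)
    then have "inv c \<otimes> h \<otimes> c = t" using True H by (simp add: subset_iff inv_solve_left' m_assoc)
    then show "inv c \<otimes> h \<otimes> c \<in> H" using t by simp
  next
    assume "inv c \<otimes> h \<otimes> c \<in> H"
    moreover have "h = c \<otimes> (inv c \<otimes> h \<otimes> c) \<otimes> inv c"
      using True that by (simp add: m_assoc flip: m_assoc[of c "inv c" h])
    ultimately show "h \<in> c <# H #> inv c" by (force simp: l_coset_def r_coset_def)
  qed
  moreover have "c <# H #> inv c \<subseteq> carrier G"
    using True H by (auto simp: l_coset_def r_coset_def)
  ultimately have "c <# H #> inv c = H \<longleftrightarrow> (\<forall>h\<in>carrier G. h \<in> H \<longleftrightarrow> inv c \<otimes> h \<otimes> c \<in> H)"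
    using H by blast
  then show ?thesis using True H by (simp add: normalizer_def stabilizer_def)
qed (simp add: normalizer_def stabilizer_def)

section \<open>The action on vertices\<close>

text \<open>An arrow carries its range and source besides the map, since fibres over different
  vertices may be equal as sets. The maps are extensional so that the unit laws hold as equations of
  HOL functions.\<close>

definition bij_groupoid ::
  "'v set \<Rightarrow> ('v \<Rightarrow> 'w set) \<Rightarrow> ('v, 'v \<times> ('w \<Rightarrow> 'w) \<times> 'v) small_cat" where
  "bij_groupoid X F = \<lparr>Obj = X,
     Arr = {(y, f, z). y \<in> X \<and> z \<in> X \<and> f \<in> extensional (F z) \<and> bij_betw f (F z) (F y)},
     src = snd \<circ> snd, rng = fst, idn = (\<lambda>y. (y, \<lambda>u\<in>F y. u, y)),
     cmp = (\<lambda>(y, f, z) (y', g, z'). (y, compose (F z') f g, z'))\<rparr>"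

lemma bij_groupoid_simps:
  "Obj (bij_groupoid X F) = X"
  "(y, f, z) \<in> Arr (bij_groupoid X F) \<longleftrightarrow>
     y \<in> X \<and> z \<in> X \<and> f \<in> extensional (F z) \<and> bij_betw f (F z) (F y)"
  "src (bij_groupoid X F) (y, f, z) = z" "rng (bij_groupoid X F) (y, f, z) = y"
  "idn (bij_groupoid X F) y = (y, \<lambda>u\<in>F y. u, y)"
  "cmp (bij_groupoid X F) (y, f, z) (y', g, z') = (y, compose (F z') f g, z')"
  by (simp_all add: bij_groupoid_def)

lemma groupoid_bij_groupoid: "groupoid (bij_groupoid X F)"
proof -
  note s = bij_groupoid_simps
  have "bij_betw (\<lambda>u\<in>A. u) A A" for A :: "'b set"
    by (auto simp: bij_betw_def inj_on_def)
  moreover have "compose B (\<lambda>u\<in>A. u) f = f" "compose B f (\<lambda>u\<in>B. u) = f"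
    if "f \<in> extensional B" "bij_betw f B A" for f :: "'b \<Rightarrow> 'b" and A B
    using that by (metis Id_compose compose_Id bij_betw_imp_funcset)+
  moreover have "compose D (compose C f g) h = compose D f (compose D g h)"
    if "bij_betw h D C" for f g h :: "'b \<Rightarrow> 'b" and C D
    using that by (metis compose_assoc bij_betw_imp_funcset)
  ultimately have "category (bij_groupoid X F)"
    unfolding category_def
    by (auto simp: s bij_betw_compose simp del: restrict_apply)
  moreover have "\<exists>b\<in>Arr (bij_groupoid X F). src (bij_groupoid X F) b = rng (bij_groupoid X F) a \<and>
      rng (bij_groupoid X F) b = src (bij_groupoid X F) a \<and>
      cmp (bij_groupoid X F) a b = idn (bij_groupoid X F) (rng (bij_groupoid X F) a) \<and>
      cmp (bij_groupoid X F) b a = idn (bij_groupoid X F) (src (bij_groupoid X F) a)"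
    if "a \<in> Arr (bij_groupoid X F)" for a
  proof -
    obtain y f z where a: "a = (y, f, z)" by (metis prod_cases3)
    \<comment> \<open>The restriction makes the inverse bijection extensional, as an arrow has to
      be.\<close>
    let ?g = "\<lambda>u\<in>F y. inv_into (F z) f u"
    have f: "y \<in> X" "z \<in> X" "bij_betw f (F z) (F y)" using that by (auto simp: a s)
    have "bij_betw ?g (F y) (F z)"
      using bij_betw_inv_into[OF f(3)] by (auto simp: bij_betw_def inj_on_def)
    then show ?thesis
      using f by (intro bexI[of _ "(z, ?g, y)"])
        (auto simp: a s compose_def fun_eq_iff bij_betw_inv_into_left bij_betw_inv_into_right
          dest: bij_betw_apply)
  qed
  ultimately show ?thesis unfolding groupoid_def by blast
qed

locale covering_groupoid =
  fixes k :: nat and Om :: "('w, 'f) graded_cat" and L :: "('v, 'e) graded_cat"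
    and p :: "('w, 'f, 'v, 'e) fmap" and G :: "('v, 'g) small_cat" and i :: "('v, 'e, 'v, 'g) fmap"
  assumes cov: "covering k Om L p" and fg: "fundamental_groupoid L G i"
begin

lemma catOm: "category Om" and catL: "category L" and p: "cat_functor Om L p"
  and deg_p: "f \<in> Arr Om \<Longrightarrow> degr L (arm p f) = degr Om f"
  using cov unfolding covering_def kgraph_def kgraph_morphism_def by blast+

lemma gG: "groupoid G" and OG: "Obj G = Obj L" and i: "cat_functor L G i"
  and i0: "y \<in> Obj L \<Longrightarrow> obm i y = y"
  using fg unfolding fundamental_groupoid_def by blast+

lemma catG: "category G"
  using gG by (simp add: groupoid_def)

lemmas cOm = category_simps[OF catOm] and cL = category_simps[OF catL] and cG = category_simps[OF catG]
  and fp = cat_functor_simps[OF p]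

lemma fi: "f \<in> Arr L \<Longrightarrow> arm i f \<in> Arr G" "f \<in> Arr L \<Longrightarrow> src G (arm i f) = src L f"
  "f \<in> Arr L \<Longrightarrow> rng G (arm i f) = rng L f"
  by (simp_all add: cat_functor_simps[OF i] i0 cL)

section \<open>Unique lifting of arrows\<close>

lemma ex1_lift:
  assumes "f \<in> Arr L" "u \<in> Obj Om" "obm p u = src L f"
  shows "\<exists>!l. l \<in> Arr Om \<and> src Om l = u \<and> arm p l = f"
proof -
  have "bij_betw (arm p) {f \<in> Arr Om. src Om f = u} {f \<in> Arr L. src L f = obm p u}"
    using cov assms(2) unfolding covering_def by blast
  then show ?thesis using assms unfolding bij_betw_def inj_on_def by (auto simp: set_eq_iff image_iff) metis+
qed

lemma ex_lift_rng:
  assumes "f \<in> Arr L" "u \<in> Obj Om" "obm p u = rng L f"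
  shows "\<exists>l. l \<in> Arr Om \<and> rng Om l = u \<and> arm p l = f"
proof -
  have "arm p ` {f \<in> Arr Om. rng Om f = u} = {f \<in> Arr L. rng L f = obm p u}"
    using cov assms(2) unfolding covering_def bij_betw_def by blast
  then have "f \<in> arm p ` {f \<in> Arr Om. rng Om f = u}" using assms by simp
  then show ?thesis by blast
qed

lemma lift_eqI:
  assumes "l \<in> Arr Om" "m \<in> Arr Om" "src Om l = src Om m" "arm p l = arm p m"
  shows "l = m"
proof -
  have "inj_on (arm p) {f \<in> Arr Om. src Om f = src Om m}"
    using cov cOm(1)[OF assms(2)] unfolding covering_def bij_betw_def by blast
  then show ?thesis using assms by (auto dest: inj_onD)
qed

lemma lift_rng_eqI:
  assumes "l \<in> Arr Om" "m \<in> Arr Om" "rng Om l = rng Om m" "arm p l = arm p m"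
  shows "l = m"
proof -
  have "inj_on (arm p) {f \<in> Arr Om. rng Om f = rng Om m}"
    using cov cOm(2)[OF assms(2)] unfolding covering_def bij_betw_def by blast
  then show ?thesis using assms by (auto dest: inj_onD)
qed

definition lift :: "'e \<Rightarrow> 'w \<Rightarrow> 'f" where
  "lift f u = (THE l. l \<in> Arr Om \<and> src Om l = u \<and> arm p l = f)"

lemma lift:
  assumes "f \<in> Arr L" "u \<in> Obj Om" "obm p u = src L f"
  shows "lift f u \<in> Arr Om" "src Om (lift f u) = u" "arm p (lift f u) = f"
    "rng Om (lift f u) \<in> Obj Om" "obm p (rng Om (lift f u)) = rng L f"
proof -
  show *: "lift f u \<in> Arr Om" "src Om (lift f u) = u" "arm p (lift f u) = f"
    using theI'[OF ex1_lift[OF assms]] unfolding lift_def by blast+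
  show "rng Om (lift f u) \<in> Obj Om" "obm p (rng Om (lift f u)) = rng L f"
    using * cOm(2) fp(4) by metis+
qed

lemma lift_p: "l \<in> Arr Om \<Longrightarrow> lift (arm p l) (src Om l) = l"
  by (intro lift_eqI) (simp_all add: lift fp cOm)

text \<open>Transport along \<open>f\<close> is injective because a lift of \<open>f\<close> is
  determined by its range, and surjective because \<open>f\<close> has a lift ending at each vertex
  over \<open>rng L f\<close>.\<close>

lemma bij_betw_lift:
  assumes f: "f \<in> Arr L"
  shows "bij_betw (\<lambda>u\<in>fibre Om p (src L f). rng Om (lift f u)) (fibre Om p (src L f)) (fibre Om p (rng L f))"
proof (rule bij_betw_imageI)
  show "inj_on (\<lambda>u\<in>fibre Om p (src L f). rng Om (lift f u)) (fibre Om p (src L f))"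
  proof (rule inj_onI)
    fix u w assume a: "u \<in> fibre Om p (src L f)" "w \<in> fibre Om p (src L f)"
      "(\<lambda>u\<in>fibre Om p (src L f). rng Om (lift f u)) u = (\<lambda>u\<in>fibre Om p (src L f). rng Om (lift f u)) w"
    then have u: "u \<in> Obj Om" "obm p u = src L f" and w: "w \<in> Obj Om" "obm p w = src L f"
      and e: "rng Om (lift f u) = rng Om (lift f w)" by (auto simp: fibre_def)
    have "lift f u = lift f w"
      using e lift[OF f u] lift[OF f w] by (intro lift_rng_eqI) simp_all
    then have "src Om (lift f u) = src Om (lift f w)" by simp
    then show "u = w" by (simp only: lift(2)[OF f u] lift(2)[OF f w])
  qed
  show "(\<lambda>u\<in>fibre Om p (src L f). rng Om (lift f u)) ` fibre Om p (src L f) = fibre Om p (rng L f)"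
  proof (intro equalityI subsetI)
    fix w assume "w \<in> fibre Om p (rng L f)"
    then obtain l where l: "l \<in> Arr Om" "rng Om l = w" "arm p l = f"
      using ex_lift_rng[OF f, of w] by (auto simp: fibre_def)
    then have "src Om l \<in> fibre Om p (src L f)" "rng Om (lift f (src Om l)) = w"
      using lift_p[OF l(1)] by (auto simp: fibre_def cOm fp)
    then show "w \<in> (\<lambda>u\<in>fibre Om p (src L f). rng Om (lift f u)) ` fibre Om p (src L f)"
      by (intro image_eqI[of _ _ "src Om l"]) auto
  qed (use f lift in \<open>auto simp: fibre_def\<close>)
qed

section \<open>Existence and uniqueness of the action on vertices\<close>

abbreviation act :: "'g \<Rightarrow> 'w \<Rightarrow> 'w" where "act \<equiv> vertex_action Om p G i"

text \<open>This is the predicate under the description operator in \<open>vertex_action\<close>,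
  named so that existence and uniqueness can be proved separately.\<close>

definition is_action :: "('g \<Rightarrow> 'w \<Rightarrow> 'w) \<Rightarrow> bool" where
  "is_action A \<longleftrightarrow> A \<in> extensional (Arr G) \<and>
     (\<forall>a\<in>Arr G. A a \<in> extensional (fibre Om p (src G a)) \<and>
        bij_betw (A a) (fibre Om p (src G a)) (fibre Om p (rng G a))) \<and>
     (\<forall>y\<in>Obj G. \<forall>u\<in>fibre Om p y. A (idn G y) u = u) \<and>
     (\<forall>a\<in>Arr G. \<forall>b\<in>Arr G. src G a = rng G b \<longrightarrow>
        (\<forall>u\<in>fibre Om p (src G b). A (cmp G a b) u = A a (A b u))) \<and>
     (\<forall>l\<in>Arr Om. A (arm i (arm p l)) (src Om l) = rng Om l)"

text \<open>Lifting is a functor \<open>F\<close> from \<open>L\<close> to the groupoid of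
  bijections. Its extension \<open>K\<close> to \<open>G\<close> has the action as middle
  component.\<close>

lemma is_action_exists: "\<exists>A. is_action A"
proof -
  let ?B = "bij_groupoid (Obj L) (fibre Om p)"
  note s = bij_groupoid_simps
  define F where "F = \<lparr>obm = (\<lambda>y\<in>Obj L. y),
    arm = (\<lambda>f\<in>Arr L. (rng L f, \<lambda>u\<in>fibre Om p (src L f). rng Om (lift f u), src L f))\<rparr>"
  \<comment> \<open>Here and in \<open>cm\<close>, both sides have the same source and the same
    image under \<open>p\<close>, so unique lifting applies.\<close>
  have id: "lift (idn L y) u = idn Om u" if "u \<in> Obj Om" "obm p u = y" for u y
    using that by (intro lift_eqI) (auto simp: lift cOm cL fp)
  have cm: "lift (cmp L f g) u = cmp Om (lift f (rng Om (lift g u))) (lift g u)"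
    if "f \<in> Arr L" "g \<in> Arr L" "src L f = rng L g" "u \<in> Obj Om" "obm p u = src L g" for f g u
    using that by (intro lift_eqI) (auto simp: lift cOm cL fp)
  have F: "cat_functor L ?B F"
    unfolding cat_functor_def
  proof (intro conjI ballI impI)
    show "arm F \<in> Arr L \<rightarrow>\<^sub>E Arr ?B"
      using bij_betw_lift by (auto simp: F_def s cL)
    show "arm F (idn L y) = idn ?B (obm F y)" if "y \<in> Obj L" for y
      using that by (auto simp: F_def s cL cOm id fibre_def fun_eq_iff)
    show "arm F (cmp L f g) = cmp ?B (arm F f) (arm F g)"
      if "f \<in> Arr L" "g \<in> Arr L" "src L f = rng L g" for f g
      using that by (auto simp: F_def s cL cOm cm lift fibre_def fun_eq_iff compose_def)
  qed (auto simp: F_def s cL)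
  obtain K where K: "cat_functor G ?B K" "functor_comp L K i = F"
    using fundamental_groupoid_universal[OF catL fg groupoid_bij_groupoid F] by blast
  have K0: "obm K y = y" if "y \<in> Obj L" for y
  proof -
    have "obm (functor_comp L K i) y = y" using that by (simp add: K(2)) (simp add: F_def)
    then show ?thesis using that by (simp add: functor_comp_def compose_def i0)
  qed
  define A where "A = (\<lambda>a\<in>Arr G. fst (snd (arm K a)))"
  \<comment> \<open>As \<open>K\<close> fixes the objects, the outer components of
    \<open>arm K a\<close> are the ends of \<open>a\<close>, and only the bijection carries
    information.\<close>
  have Ka: "arm K a = (rng G a, A a, src G a)" if "a \<in> Arr G" for a
    using that cat_functor_simps(3,4)[OF K(1) that] cG(1,2)[OF that]
    by (cases "arm K a") (auto simp: A_def s K0 OG)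
  have "is_action A"
    unfolding is_action_def
  proof (intro conjI ballI impI)
    show "A \<in> extensional (Arr G)" by (simp add: A_def)
    fix a assume a: "a \<in> Arr G"
    show "A a \<in> extensional (fibre Om p (src G a))"
      "bij_betw (A a) (fibre Om p (src G a)) (fibre Om p (rng G a))"
      using cat_functor_simps(2)[OF K(1) a] by (simp_all add: Ka[OF a] s)
  next
    fix y u assume y: "y \<in> Obj G" "u \<in> fibre Om p y"
    then show "A (idn G y) u = u"
      using cat_functor_simps(5)[OF K(1) y(1)] Ka[of "idn G y"] by (simp add: s K0 OG cG)
  next
    fix a b u assume "a \<in> Arr G" "b \<in> Arr G" "src G a = rng G b" "u \<in> fibre Om p (src G b)"
    then show "A (cmp G a b) u = A a (A b u)"
      using cat_functor_simps(6)[OF K(1), of a b] Ka[of "cmp G a b"]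
      by (simp add: s cG Ka compose_def)
  next
    fix l assume l: "l \<in> Arr Om"
    have "arm (functor_comp L K i) (arm p l) = arm F (arm p l)" by (simp add: K(2))
    then have "arm K (arm i (arm p l)) = arm F (arm p l)"
      using l by (simp add: functor_comp_def compose_def fp)
    then show "A (arm i (arm p l)) (src Om l) = rng Om l"
      using l by (simp add: Ka fi fp F_def fibre_def cOm lift_p)
  qed
  then show ?thesis by blast
qed

lemma is_actionD:
  assumes "is_action A"
  shows "\<lbrakk>a \<in> Arr G; u \<in> fibre Om p (src G a)\<rbrakk> \<Longrightarrow> A a u \<in> fibre Om p (rng G a)"
    "\<lbrakk>y \<in> Obj G; u \<in> fibre Om p y\<rbrakk> \<Longrightarrow> A (idn G y) u = u"
    "\<lbrakk>a \<in> Arr G; b \<in> Arr G; src G a = rng G b; u \<in> fibre Om p (src G b)\<rbrakk> \<Longrightarrow>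
      A (cmp G a b) u = A a (A b u)"
    "l \<in> Arr Om \<Longrightarrow> A (arm i (arm p l)) (src Om l) = rng Om l"
  using assms unfolding is_action_def by (blast dest: bij_betw_apply)+

text \<open>On generators the action is prescribed by the lifts, and the induction principle spreads
  the agreement to all of \<open>G\<close>.\<close>

lemma is_action_unique:
  assumes A: "is_action A" and B: "is_action B" and a: "a \<in> Arr G" and u: "u \<in> fibre Om p (src G a)"
  shows "A a u = B a u"
  using catL fg a u
proof (induction a arbitrary: u rule: fundamental_groupoid_induct)
  case (gen f)
  then have "u \<in> Obj Om" "obm p u = src L f" by (auto simp: fibre_def fi)
  note l = lift[OF gen(1) this]
  show ?case using is_actionD(4)[OF A l(1)] is_actionD(4)[OF B l(1)] by (simp add: l)
next
  case (cmp a b)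
  have u: "u \<in> fibre Om p (src G b)" using cmp by (simp add: cG)
  then have "B b u \<in> fibre Om p (src G a)"
    using is_actionD(1)[OF B cmp(2)] cmp(3) by simp
  then show ?case
    using cmp u is_actionD(3)[OF A cmp(1,2,3) u] is_actionD(3)[OF B cmp(1,2,3) u] by simp
next
  case (inv a b)
  have b: "b \<in> Arr G" "src G b = rng G a" "rng G b = src G a" and ab: "cmp G a b = idn G (rng G a)"
    "cmp G b a = idn G (src G a)"
    using inv(2) by (simp_all add: is_ginv_def)
  have u: "u \<in> fibre Om p (rng G a)" using inv(4) b by simp
  have w: "A b u \<in> fibre Om p (src G a)"
    using is_actionD(1)[OF A b(1) inv(4)] b by simp
  \<comment> \<open>The induction hypothesis speaks of \<open>a\<close>, so it is used at the vertex
    \<open>A b u\<close>: it gives \<open>B a (A b u) = u\<close>, and applying \<open>B b\<close>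
    yields \<open>A b u = B b u\<close>.\<close>
  have "A a (A b u) = u"
    using is_actionD(3)[OF A inv(1) b(1) b(3)[symmetric] inv(4)]
      is_actionD(2)[OF A cG(2)[OF inv(1)] u] ab by simp
  then have "B a (A b u) = u" using inv(3)[OF w] by simp
  moreover have "B b (B a (A b u)) = A b u"
    using is_actionD(3)[OF B b(1) inv(1) b(2) w]
      is_actionD(2)[OF B cG(1)[OF inv(1)] w] ab by simp
  ultimately show ?case by simp
qed

text \<open>The two extensionality clauses turn agreement on fibres into equality of functions, so
  the description in \<open>vertex_action\<close> has exactly one solution.\<close>

lemma is_action_act: "is_action act"
proof -
  have "A = B" if A: "is_action A" and B: "is_action B" for A B
  proof (rule extensionalityI[of _ "Arr G"])
    show "A \<in> extensional (Arr G)" "B \<in> extensional (Arr G)" using A B by (auto simp: is_action_def)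
    show "A a = B a" if "a \<in> Arr G" for a
      by (rule extensionalityI[of _ "fibre Om p (src G a)"])
        (use A B that is_action_unique[OF A B] in \<open>auto simp: is_action_def\<close>)
  qed
  then have "\<exists>!A. is_action A" using is_action_exists by blast
  from theI'[OF this] show ?thesis unfolding vertex_action_def is_action_def[abs_def] .
qed

lemma act_Obj:
  assumes "a \<in> Arr G" "u \<in> Obj Om" "obm p u = src G a"
  shows "act a u \<in> Obj Om" "obm p (act a u) = rng G a"
  using is_actionD(1)[OF is_action_act] assms by (auto simp: fibre_def)

lemma act_idn: "u \<in> Obj Om \<Longrightarrow> act (idn G (obm p u)) u = u"
  using is_actionD(2)[OF is_action_act] by (auto simp: fibre_def OG fp)

lemma act_cmp:
  "\<lbrakk>a \<in> Arr G; b \<in> Arr G; src G a = rng G b; u \<in> Obj Om; obm p u = src G b\<rbrakk> \<Longrightarrow>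
    act (cmp G a b) u = act a (act b u)"
  using is_actionD(3)[OF is_action_act] by (auto simp: fibre_def)

lemmas act_arr = is_actionD(4)[OF is_action_act]

lemma ginv:
  assumes "a \<in> Arr G"
  shows "ginv G a \<in> Arr G" "src G (ginv G a) = rng G a" "rng G (ginv G a) = src G a"
    "cmp G a (ginv G a) = idn G (rng G a)" "cmp G (ginv G a) a = idn G (src G a)"
  using is_ginv_ginv[OF gG assms] by (simp_all add: is_ginv_def)

lemma act_ginv_act:
  assumes "a \<in> Arr G" "u \<in> Obj Om" "obm p u = src G a"
  shows "act (ginv G a) (act a u) = u"
  using act_cmp[of "ginv G a" a u] act_idn[of u] assms by (simp add: ginv)

lemma act_act_ginv:
  assumes "a \<in> Arr G" "u \<in> Obj Om" "obm p u = rng G a"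
  shows "act a (act (ginv G a) u) = u"
  using act_cmp[of a "ginv G a" u] act_idn[of u] assms by (simp add: ginv)

section \<open>Equivariance of deck transformations\<close>

lemma deck_p:
  assumes "functor_comp Om p F = p"
  shows "w \<in> Obj Om \<Longrightarrow> obm p (obm F w) = obm p w" "l \<in> Arr Om \<Longrightarrow> arm p (arm F l) = arm p l"
  using arg_cong[OF assms, of "\<lambda>K. obm K w"] arg_cong[OF assms, of "\<lambda>K. arm K l"]
  by (simp_all add: functor_comp_def compose_def)

text \<open>On generators this holds because \<open>F\<close> carries the lift of \<open>f\<close>
  at \<open>u\<close> to the lift of \<open>f\<close> at \<open>obm F u\<close>; the rest is
  induction over \<open>G\<close>.\<close>

lemma act_deck:
  assumes F: "cat_functor Om Om F" "functor_comp Om p F = p"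
    and a: "a \<in> Arr G" and u: "u \<in> Obj Om" "obm p u = src G a"
  shows "obm F (act a u) = act a (obm F u)"
proof -
  note fF = cat_functor_simps[OF F(1)] and pF = deck_p[OF F(2)]
  show ?thesis
    using catL fg a u
  proof (induction a arbitrary: u rule: fundamental_groupoid_induct)
    case (gen f)
    define l where "l = lift f u"
    have l: "l \<in> Arr Om" "src Om l = u" "arm p l = f"
      unfolding l_def using gen by (simp_all add: lift fi)
    have "act f' u = rng Om l" if "f' = arm i f" for f' using act_arr[OF l(1)] l that by simp
    moreover have "act (arm i f) (obm F u) = rng Om (arm F l)"
      using act_arr[of "arm F l"] l pF(2)[OF l(1)] by (simp add: fF)
    ultimately show ?case using l by (simp add: fF)
  next
    case (cmp a b)
    then show ?case by (simp add: cG act_cmp act_Obj pF fF)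
  next
    case (inv a b)
    have "b = ginv G a" using is_ginv_unique[OF catG inv(1,2)] is_ginv_ginv[OF gG inv(1)] by simp
    note b = this ginv[OF inv(1)]
    \<comment> \<open>The hypothesis on \<open>a\<close> is applied at \<open>act b u\<close>, which
      \<open>a\<close> sends back to \<open>u\<close>; applying \<open>b\<close> to both sides then
      isolates \<open>obm F (act b u)\<close>.\<close>
    have "obm F (act a (act b u)) = act a (obm F (act b u))"
      using inv b by (intro inv(3)) (auto simp: act_Obj)
    then have "obm F u = act a (obm F (act b u))" using inv b by (simp add: act_act_ginv)
    then show ?case using inv b by (simp add: act_ginv_act act_Obj fF pF)
  qed
qed

section \<open>The image of the fundamental group as a stabilizer\<close>

text \<open>Arrows of \<open>G\<close> lift to \<open>GOm\<close> from any prescribed source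
  (\<open>lift_P\<close>), and the action of the image of an arrow moves its source to its range
  (\<open>act_P\<close>). Hence a loop fixes \<open>u\<close> exactly when it lifts to a loop at
  \<open>u\<close>.\<close>

lemma image_isotropy_group:
  fixes GOm :: "('w, 'h) small_cat" and iOm :: "('w, 'f, 'w, 'h) fmap"
  assumes fgOm: "fundamental_groupoid Om GOm iOm" and u: "u \<in> Obj Om"
  shows "arm (induced_functor Om GOm iOm G i p) ` carrier (isotropy_group GOm u) =
    {a \<in> carrier (isotropy_group G (obm p u)). act a u = u}"
proof -
  define P where "P = induced_functor Om GOm iOm G i p"
  have P: "cat_functor GOm G P" and Pi: "functor_comp Om P iOm = functor_comp Om i p"
    unfolding P_def by (rule induced_functor_universal[OF catOm catL fgOm fg p])+
  note fP = cat_functor_simps[OF P]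
  have gOm: "groupoid GOm" and OOm: "Obj GOm = Obj Om" and iOm: "cat_functor Om GOm iOm"
    and iOm0: "\<And>w. w \<in> Obj Om \<Longrightarrow> obm iOm w = w"
    using fgOm unfolding fundamental_groupoid_def by blast+
  have catGOm: "category GOm" using gOm by (simp add: groupoid_def)
  note cGOm = category_simps[OF catGOm] and fiOm = cat_functor_simps[OF iOm]
  have P0: "obm P w = obm p w" if "w \<in> Obj Om" for w
    using arg_cong[OF Pi, of "\<lambda>K. obm K w"] that
    by (simp add: functor_comp_def compose_def iOm0 i0 fp)
  have P1: "arm P (arm iOm l) = arm i (arm p l)" if "l \<in> Arr Om" for l
    using arg_cong[OF Pi, of "\<lambda>K. arm K l"] that by (simp add: functor_comp_def compose_def)
  have ends: "src G (arm P b) = obm p (src GOm b)" "rng G (arm P b) = obm p (rng GOm b)"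
    "src GOm b \<in> Obj Om" "rng GOm b \<in> Obj Om" if "b \<in> Arr GOm" for b
    using that cGOm(1,2)[OF that] by (simp_all add: fP OOm P0)
  have act_P: "act (arm P b) (src GOm b) = rng GOm b" if "b \<in> Arr GOm" for b
    using catOm fgOm that
  proof (induction b rule: fundamental_groupoid_induct)
    case (gen l)
    then show ?case using act_arr[OF gen] by (simp add: P1 fiOm iOm0 cOm)
  next
    case (cmp a b)
    then show ?case by (simp add: fP(2,6) act_cmp ends cGOm(7,8))
  next
    case (inv a b)
    then have b: "b \<in> Arr GOm" "src GOm b = rng GOm a" "rng GOm b = src GOm a"
      "cmp GOm b a = idn GOm (src GOm a)" by (simp_all add: is_ginv_def)
    have "act (arm P b) (act (arm P a) (src GOm a)) = act (arm P (cmp GOm b a)) (src GOm a)"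
      using b(1-3) inv(1) by (simp add: fP(2,6) act_cmp ends)
    also have "\<dots> = src GOm a"
      using ends(3)[OF inv(1)] by (simp add: b(4) fP OOm P0 act_idn)
    finally show ?case using inv(3) b by simp
  qed
  \<comment> \<open>The vertex \<open>u\<close> stays arbitrary in the induction, since for a
    composite the lift of the left factor must start where that of the right factor ends.\<close>
  have lift_P: "\<exists>b\<in>Arr GOm. src GOm b = u \<and> arm P b = a"
    if "a \<in> Arr G" "u \<in> Obj Om" "obm p u = src G a" for a u
    using catL fg that
  proof (induction a arbitrary: u rule: fundamental_groupoid_induct)
    case (gen f)
    then have "lift f u \<in> Arr Om" "src Om (lift f u) = u" "arm p (lift f u) = f"
      by (simp_all add: lift fi)
    then show ?case by (intro bexI[of _ "arm iOm (lift f u)"]) (simp_all add: P1 fiOm iOm0 gen)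
  next
    case (cmp a b)
    obtain b' where b': "b' \<in> Arr GOm" "src GOm b' = u" "arm P b' = b"
      using cmp(5)[of u] cmp(1-3,6,7) by (simp add: cG) blast
    obtain a' where a': "a' \<in> Arr GOm" "src GOm a' = rng GOm b'" "arm P a' = a"
      using cmp(4)[of "rng GOm b'"] cmp(3) ends[OF b'(1)] b' by (simp add: cG) blast
    show ?case using a' b' by (intro bexI[of _ "cmp GOm a' b'"]) (simp_all add: cGOm fP)
  next
    case (inv a b)
    have b: "b \<in> Arr G" "src G b = rng G a" "rng G b = src G a" "cmp G a b = idn G (rng G a)"
      using inv(2) by (simp_all add: is_ginv_def)
    \<comment> \<open>The inverse \<open>b\<close> is lifted by inverting the lift of
      \<open>a\<close> that starts at \<open>act b u\<close>. By \<open>act_P\<close> this lift ends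
      at \<open>u\<close>, so its inverse starts there.\<close>
    have w: "act b u \<in> Obj Om" "obm p (act b u) = src G a"
      using act_Obj[OF b(1) inv(4,5)] b by simp_all
    obtain a' where a': "a' \<in> Arr GOm" "src GOm a' = act b u" "arm P a' = a"
      using inv(3)[OF w] by blast
    have "rng GOm a' = act a (act b u)" using act_P[OF a'(1)] a' by simp
    also have "\<dots> = act (cmp G a b) u" using act_cmp[of a b u] inv b by simp
    also have "\<dots> = u" using act_idn[of u] inv b by simp
    finally have r: "rng GOm a' = u" .
    note gi = is_ginv_ginv[OF gOm a'(1), unfolded is_ginv_def]
    have "is_ginv G (arm P a') (arm P (ginv GOm a'))"
      unfolding is_ginv_def using gi a'(1) fP(6)[of a' "ginv GOm a'"] fP(6)[of "ginv GOm a'" a']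
      by (simp add: fP cGOm)
    then have "arm P (ginv GOm a') = b" using is_ginv_unique[OF catG inv(1) _ inv(2)] a' by simp
    then show ?case using gi r by (intro bexI[of _ "ginv GOm a'"]) simp_all
  qed
  show ?thesis
  proof (intro equalityI subsetI)
    fix a assume "a \<in> arm (induced_functor Om GOm iOm G i p) ` carrier (isotropy_group GOm u)"
    then obtain b where "b \<in> Arr GOm" "rng GOm b = u" "src GOm b = u" "a = arm P b"
      by (auto simp: isotropy_group_def P_def)
    then show "a \<in> {a \<in> carrier (isotropy_group G (obm p u)). act a u = u}"
      using act_P[of b] by (simp add: isotropy_group_def fP P0 u)
  next
    fix a assume "a \<in> {a \<in> carrier (isotropy_group G (obm p u)). act a u = u}"
    then have a: "a \<in> Arr G" "src G a = obm p u" "act a u = u" by (auto simp: isotropy_group_def)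
    then obtain b where b: "b \<in> Arr GOm" "src GOm b = u" "arm P b = a" using lift_P[of a u] u by auto
    then have "rng GOm b = u" using act_P[of b] a by simp
    then show "a \<in> arm (induced_functor Om GOm iOm G i p) ` carrier (isotropy_group GOm u)"
      using b by (auto simp: isotropy_group_def P_def)
  qed
qed

end

section \<open>The normalizer and deck transformations\<close>

locale connected_covering = covering_groupoid +
  fixes v
  assumes conn: "connected_cat Om" and v: "v \<in> Obj Om"
begin

section \<open>The base vertex, its stabilizer and the normalizer\<close>

abbreviation x where "x \<equiv> obm p v"

abbreviation \<pi> where "\<pi> \<equiv> isotropy_group G x"

text \<open>By \<open>image_isotropy_group\<close> this is the image of the fundamental group of the
  covering at \<open>v\<close>; as a stabilizer it can be handled inside \<open>G\<close>
  alone.\<close>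

definition stab where "stab = {a \<in> carrier \<pi>. act a v = v}"

definition norm_stab where "norm_stab = normalizer \<pi> stab"

lemma carrier_\<pi>: "a \<in> carrier \<pi> \<longleftrightarrow> a \<in> Arr G \<and> src G a = x \<and> rng G a = x"
  by (auto simp: isotropy_group_def)

lemma group_\<pi>: "group \<pi>"
  using group_isotropy_group[OF gG] v by (simp add: OG fp)

lemma inv_\<pi>:
  assumes "c \<in> carrier \<pi>"
  shows "inv\<^bsub>\<pi>\<^esub> c = ginv G c" "ginv G c \<in> carrier \<pi>"
proof -
  have c: "c \<in> Arr G" "src G c = x" "rng G c = x" using assms by (simp_all add: carrier_\<pi>)
  then show *: "ginv G c \<in> carrier \<pi>" by (simp add: carrier_\<pi> ginv)
  show "inv\<^bsub>\<pi>\<^esub> c = ginv G c"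
    by (rule group.inv_equality[OF group_\<pi> _ assms *]) (use c in \<open>simp add: isotropy_group_def ginv\<close>)
qed

text \<open>Connectedness joins \<open>v\<close> to \<open>u\<close> by a zigzag of arrows. Each
  one, traversed forwards, acts through its image in \<open>G\<close>, and backwards through the
  inverse of that image.\<close>

lemma transitive:
  assumes "u \<in> Obj Om"
  shows "\<exists>a\<in>Arr G. src G a = x \<and> act a v = u"
proof -
  have "equivclp (\<lambda>u w. \<exists>f\<in>Arr Om. rng Om f = u \<and> src Om f = w) v u"
    using conn v assms unfolding connected_cat_def by blast
  then show ?thesis
  proof (induction rule: equivclp_induct)
    case base
    have "idn G x \<in> Arr G" "src G (idn G x) = x" using v by (simp_all add: cG OG fp)
    then show ?case using act_idn[OF v] by blast
  next
    case (step w z)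
    then obtain a where a: "a \<in> Arr G" "src G a = x" "act a v = w" by blast
    note w = act_Obj[OF a(1) v a(2)[symmetric], unfolded a(3)]
    from step(2) consider l where "l \<in> Arr Om" "src Om l = w" "rng Om l = z"
      | l where "l \<in> Arr Om" "rng Om l = w" "src Om l = z" by blast
    then show ?case
    proof cases
      case 1
      define b where "b = arm i (arm p l)"
      have b: "b \<in> Arr G" "src G b = rng G a" "act b w = z"
        using 1 w act_arr[OF 1(1)] by (simp_all add: b_def fi fp)
      then show ?thesis
        using a v act_cmp[of b a v] by (intro bexI[of _ "cmp G b a"]) (simp_all add: cG)
    next
      case 2
      define b where "b = arm i (arm p l)"
      have b: "b \<in> Arr G" "rng G b = rng G a" "act b z = w" "src G b = obm p z" "z \<in> Obj Om"
        using 2 w act_arr[OF 2(1)] cOm(1)[OF 2(1)] by (simp_all add: b_def fi fp)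
      then have "act (ginv G b) w = z" using act_ginv_act[of b z] by simp
      then show ?thesis
        using a v b act_cmp[of "ginv G b" a v]
        by (intro bexI[of _ "cmp G (ginv G b) a"]) (simp_all add: cG ginv)
    qed
  qed
qed

text \<open>\<open>c\<^sup>-\<^sup>1hc\<close> fixes \<open>v\<close> if and only if \<open>h\<close> fixes \<open>cv\<close>.\<close>

lemma mem_norm_stab:
  "c \<in> norm_stab \<longleftrightarrow> c \<in> carrier \<pi> \<and>
    (\<forall>h\<in>carrier \<pi>. act h v = v \<longleftrightarrow> act h (act c v) = act c v)"
proof (cases "c \<in> carrier \<pi>")
  case c: True
  interpret group \<pi> by (rule group_\<pi>)
  have "inv\<^bsub>\<pi>\<^esub> c \<otimes>\<^bsub>\<pi>\<^esub> h \<otimes>\<^bsub>\<pi>\<^esub> c \<in> stab \<longleftrightarrow> act h (act c v) = act c v"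
    if h: "h \<in> carrier \<pi>" for h
  proof -
    have c': "c \<in> Arr G" "src G c = x" "rng G c = x" and h': "h \<in> Arr G" "src G h = x" "rng G h = x"
      using c h by (simp_all add: carrier_\<pi>)
    note i = ginv[OF c'(1)]
    have cv: "act c v \<in> Obj Om" "obm p (act c v) = x" using act_Obj[of c v] c' v by simp_all
    have hcv: "act h (act c v) \<in> Obj Om" "obm p (act h (act c v)) = x"
      using act_Obj[of h "act c v"] cv h' by simp_all
    have "act (cmp G (cmp G (ginv G c) h) c) v = act (ginv G c) (act h (act c v))"
      using c' h' i cv v by (simp add: act_cmp cG)
    moreover have "act (ginv G c) (act h (act c v)) = v \<longleftrightarrow> act h (act c v) = act c v"
      using act_act_ginv[OF c'(1) hcv(1)] act_ginv_act[OF c'(1) v] hcv c' by auto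
    moreover have "inv\<^bsub>\<pi>\<^esub> c \<otimes>\<^bsub>\<pi>\<^esub> h \<otimes>\<^bsub>\<pi>\<^esub> c \<in> carrier \<pi>" using c h by simp
    ultimately show ?thesis using inv_\<pi>(1)[OF c] by (simp add: stab_def isotropy_group_def)
  qed
  moreover have "stab \<subseteq> carrier \<pi>" by (auto simp: stab_def)
  ultimately show ?thesis using mem_normalizer_iff[of stab c] by (auto simp: norm_stab_def stab_def)
qed (simp add: norm_stab_def normalizer_def stabilizer_def)

lemma subgroup_norm_stab: "subgroup norm_stab \<pi>"
  unfolding norm_stab_def by (rule group.normalizer_imp_subgroup[OF group_\<pi>]) (auto simp: stab_def)

lemma stab_subset_norm_stab: "stab \<subseteq> norm_stab"
  by (auto simp: mem_norm_stab stab_def)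

lemma norm_stab_Arr:
  assumes "c \<in> norm_stab"
  shows "c \<in> Arr G" "src G c = x" "rng G c = x"
  using assms by (simp_all add: mem_norm_stab carrier_\<pi>)

lemma norm_stab_carrier: "c \<in> norm_stab \<Longrightarrow> c \<in> carrier \<pi>"
  by (rule subgroup.mem_carrier[OF subgroup_norm_stab])

lemma idn_norm_stab: "idn G x \<in> norm_stab"
  using subgroup.one_closed[OF subgroup_norm_stab] by (simp add: isotropy_group_def)

lemma cmp_norm_stab: "c \<in> norm_stab \<Longrightarrow> c' \<in> norm_stab \<Longrightarrow> cmp G c c' \<in> norm_stab"
  using subgroup.m_closed[OF subgroup_norm_stab] by (simp add: isotropy_group_def)

lemma ginv_norm_stab: "c \<in> norm_stab \<Longrightarrow> ginv G c \<in> norm_stab"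
  using subgroup.m_inv_closed[OF subgroup_norm_stab, of c] inv_\<pi>(1)[OF norm_stab_carrier, of c] by simp

section \<open>Translation of vertices by the normalizer\<close>

text \<open>The loop \<open>h\<close>, the inverse of \<open>b\<close> followed on the right by
  \<open>a\<close>, fixes \<open>v\<close>. Since \<open>c\<close> normalizes the stabilizer,
  \<open>h\<close> also fixes \<open>act c v\<close>, which says that \<open>a\<close> and
  \<open>b\<close> agree there.\<close>

lemma act_normalizer_well_defined:
  assumes c: "c \<in> norm_stab" and a: "a \<in> Arr G" "src G a = x" and b: "b \<in> Arr G" "src G b = x"
    and e: "act a v = act b v"
  shows "act (cmp G a c) v = act (cmp G b c) v"
proof -
  note c' = norm_stab_Arr[OF c] and i = ginv[OF b(1)]
  have cv: "act c v \<in> Obj Om" "obm p (act c v) = x" using act_Obj[of c v] c' v by simp_all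
  have r: "rng G a = rng G b" using act_Obj(2)[of a v] act_Obj(2)[of b v] a b v e by simp
  define h where "h = cmp G (ginv G b) a"
  have h: "h \<in> carrier \<pi>" using a b r i by (simp add: h_def carrier_\<pi> cG)
  have "act h v = v" using act_cmp[of "ginv G b" a v] act_ginv_act[of b v] a b r i v e by (simp add: h_def)
  then have "act h (act c v) = act c v" using c h by (simp add: mem_norm_stab)
  then have "act (ginv G b) (act a (act c v)) = act c v"
    using act_cmp[of "ginv G b" a "act c v"] a b r i cv by (simp add: h_def)
  then have "act a (act c v) = act b (act c v)"
    using act_act_ginv[of b "act a (act c v)"] act_Obj[of a "act c v"] a b cv r by simp
  moreover have "act (cmp G a c) v = act a (act c v)" "act (cmp G b c) v = act b (act c v)"
    using a b c' v by (simp_all add: act_cmp)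
  ultimately show ?thesis by simp
qed

text \<open>The vertex part of the right action, sending \<open>av\<close> to \<open>acv\<close>.
  For \<open>c\<close> in the normalizer the chosen \<open>a\<close> does not affect the value, by
  \<open>act_normalizer_well_defined\<close>.\<close>

definition vtranslate where "vtranslate c u = act (cmp G (SOME a. a \<in> Arr G \<and> src G a = x \<and> act a v = u) c) v"

lemma vtranslate:
  assumes "c \<in> norm_stab" "a \<in> Arr G" "src G a = x"
  shows "vtranslate c (act a v) = act (cmp G a c) v"
proof -
  let ?b = "SOME b. b \<in> Arr G \<and> src G b = x \<and> act b v = act a v"
  have "?b \<in> Arr G \<and> src G ?b = x \<and> act ?b v = act a v"
    by (rule someI[of _ a]) (use assms in simp)
  then show ?thesis using act_normalizer_well_defined[OF assms(1), of ?b a] assms by (simp add: vtranslate_def)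
qed

lemma vtranslate_Obj:
  assumes c: "c \<in> norm_stab" and u: "u \<in> Obj Om"
  shows "vtranslate c u \<in> Obj Om" "obm p (vtranslate c u) = obm p u"
proof -
  obtain a where a: "a \<in> Arr G" "src G a = x" "act a v = u" using transitive[OF u] by blast
  have u': "obm p u = rng G a" using act_Obj(2)[OF a(1) v] a(2,3) by simp
  have t: "vtranslate c u = act (cmp G a c) v" using vtranslate[OF c a(1,2)] by (simp only: a(3))
  have ac: "cmp G a c \<in> Arr G" "x = src G (cmp G a c)" "rng G (cmp G a c) = rng G a"
    using a(1,2) norm_stab_Arr[OF c] by (simp_all add: cG)
  show "vtranslate c u \<in> Obj Om" "obm p (vtranslate c u) = obm p u"
    unfolding t u' using act_Obj[OF ac(1) v ac(2)] ac(3) by simp_all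
qed

text \<open>Writing \<open>u = av\<close>, both sides equal \<open>bacv\<close>: \<open>G\<close>
  acts on the left of \<open>a\<close> and \<open>c\<close> on its right. This is what makes
  translation compatible with ranges.\<close>

lemma act_vtranslate:
  assumes c: "c \<in> norm_stab" and u: "u \<in> Obj Om" and b: "b \<in> Arr G" "src G b = obm p u"
  shows "act b (vtranslate c u) = vtranslate c (act b u)"
proof -
  obtain a where a: "a \<in> Arr G" "src G a = x" "act a v = u" using transitive[OF u] by blast
  have r: "src G b = rng G a" using act_Obj(2)[OF a(1) v] a(2,3) b(2) by simp
  note c' = norm_stab_Arr[OF c]
  have ba: "cmp G b a \<in> Arr G" "src G (cmp G b a) = x" using a(1,2) b(1) r by (simp_all add: cG)
  have "act b (vtranslate c u) = act b (act (cmp G a c) v)"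
    using vtranslate[OF c a(1,2)] by (simp only: a(3))
  also have "\<dots> = act (cmp G b (cmp G a c)) v"
    by (rule act_cmp[symmetric]) (use a(1,2) b(1) r c' v in \<open>simp_all add: cG\<close>)
  also have "\<dots> = act (cmp G (cmp G b a) c) v"
    using a(1,2) b(1) r c' by (simp add: cG)
  also have "\<dots> = vtranslate c (act (cmp G b a) v)" by (rule vtranslate[OF c ba, symmetric])
  also have "act (cmp G b a) v = act b u"
    using act_cmp[OF b(1) a(1) r v a(2)[symmetric]] by (simp only: a(3))
  finally show ?thesis .
qed

section \<open>The right action on arrows\<close>

lemma connects_iff:
  "connects Om p G i v l a \<longleftrightarrow> a \<in> Arr G \<and> src G a = x \<and> act a v = src Om l"
  by (auto simp: connects_def)

lemma connects_exists: "l \<in> Arr Om \<Longrightarrow> \<exists>a. connects Om p G i v l a"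
  using transitive[of "src Om l"] cOm(1) by (auto simp: connects_iff)

text \<open>Every admissible \<open>a\<close> prescribes the same source, so the translate is the
  unique lift of \<open>arm p l\<close> at that vertex. The right-hand side is free of
  \<open>a\<close>, which settles independence of the choice.\<close>

lemma is_translate_iff:
  assumes c: "c \<in> norm_stab" and l: "l \<in> Arr Om" and a: "connects Om p G i v l a"
  shows "is_translate Om p G i v l a c m \<longleftrightarrow> m = lift (arm p l) (vtranslate c (src Om l))"
proof -
  have t: "vtranslate c (src Om l) = act (cmp G a c) v" using a vtranslate[OF c, of a] by (simp add: connects_iff)
  have "lift (arm p l) (vtranslate c (src Om l)) \<in> Arr Om" "src Om (lift (arm p l) (vtranslate c (src Om l))) = vtranslate c (src Om l)"
    "arm p (lift (arm p l) (vtranslate c (src Om l))) = arm p l"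
    using lift(1-3)[of "arm p l" "vtranslate c (src Om l)"] vtranslate_Obj[OF c cOm(1)[OF l]] l by (simp_all add: fp)
  then show ?thesis unfolding is_translate_def t[symmetric] by (auto intro: lift_eqI)
qed

lemma right_action_eq:
  assumes c: "c \<in> norm_stab" and l: "l \<in> Arr Om"
  shows "right_action Om p G i v l c = lift (arm p l) (vtranslate c (src Om l))"
  unfolding right_action_def is_translate_iff[OF c l someI_ex[OF connects_exists[OF l]]] by simp

lemma right_action:
  assumes c: "c \<in> norm_stab" and l: "l \<in> Arr Om"
  shows "right_action Om p G i v l c \<in> Arr Om" "arm p (right_action Om p G i v l c) = arm p l"
    "src Om (right_action Om p G i v l c) = vtranslate c (src Om l)"
    "rng Om (right_action Om p G i v l c) = vtranslate c (rng Om l)"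
proof -
  let ?m = "right_action Om p G i v l c"
  show *: "?m \<in> Arr Om" "arm p ?m = arm p l" "src Om ?m = vtranslate c (src Om l)"
    using lift(1-3)[of "arm p l" "vtranslate c (src Om l)"] vtranslate_Obj[OF c cOm(1)[OF l]] l
    by (simp_all add: fp right_action_eq[OF c l])
  \<comment> \<open>The definition of the translate prescribes only its source. Its range is
    obtained by letting the common image of \<open>l\<close> and \<open>?m\<close> act on that
    source.\<close>
  have "rng Om ?m = act (arm i (arm p l)) (vtranslate c (src Om l))"
    using act_arr[OF *(1)] by (simp add: *)
  also have "\<dots> = vtranslate c (act (arm i (arm p l)) (src Om l))"
    using act_vtranslate[OF c cOm(1)[OF l]] l by (simp add: fi fp)
  finally show "rng Om ?m = vtranslate c (rng Om l)" by (simp add: act_arr l)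
qed

section \<open>Translations as covering automorphisms\<close>

abbreviation tr where "tr \<equiv> translation Om p G i v"

lemma tr_simps:
  assumes "c \<in> norm_stab"
  shows "u \<in> Obj Om \<Longrightarrow> obm (tr c) u = vtranslate c u"
    "l \<in> Arr Om \<Longrightarrow> arm (tr c) l = right_action Om p G i v l c"
  using right_action(3)[OF assms, of "idn Om u"] by (simp_all add: translation_def cOm)

lemma obm_tr_v: "c \<in> norm_stab \<Longrightarrow> obm (tr c) v = act c v"
  using vtranslate[of c "idn G x"] act_idn[OF v] v cG(9)[of c] norm_stab_Arr[of c] by (simp add: tr_simps cG OG fp)

text \<open>Preservation of units and products follows from unique lifting: both sides lie over the
  same arrow and have the same source.\<close>

lemma cat_functor_tr:
  assumes c: "c \<in> norm_stab"
  shows "cat_functor Om Om (tr c)"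
  unfolding cat_functor_def
proof (intro conjI ballI impI)
  note t = tr_simps[OF c] and r = right_action[OF c] and o = vtranslate_Obj[OF c]
  \<comment> \<open>The closing \<open>simp\<close> here and for arrows treats arguments outside the
    domain, where \<open>translation\<close> is \<open>undefined\<close>.\<close>
  show "obm (tr c) \<in> Obj Om \<rightarrow>\<^sub>E Obj Om"
    using o by (auto simp: t) (simp add: translation_def)
  show "arm (tr c) \<in> Arr Om \<rightarrow>\<^sub>E Arr Om"
    using r by (auto simp: t) (simp add: translation_def)
  show "src Om (arm (tr c) f) = obm (tr c) (src Om f)" "rng Om (arm (tr c) f) = obm (tr c) (rng Om f)"
    if "f \<in> Arr Om" for f
    using that by (simp_all add: t r cOm)
  show "arm (tr c) (idn Om u) = idn Om (obm (tr c) u)" if "u \<in> Obj Om" for u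
    using that o by (intro lift_eqI) (simp_all add: t r cOm fp)
  show "arm (tr c) (cmp Om f g) = cmp Om (arm (tr c) f) (arm (tr c) g)"
    if "f \<in> Arr Om" "g \<in> Arr Om" "src Om f = rng Om g" for f g
    using that by (intro lift_eqI) (simp_all add: t r cOm fp)
qed

lemma p_tr:
  assumes c: "c \<in> norm_stab"
  shows "functor_comp Om p (tr c) = p"
  by (rule fmap_eqI[OF cat_functor_functor_comp[OF catOm cat_functor_tr[OF c] p] p])
    (simp_all add: functor_comp_def compose_def tr_simps[OF c] right_action[OF c] vtranslate_Obj[OF c])

text \<open>Transitivity and equivariance spread the agreement from \<open>v\<close> to all
  vertices; unique lifting extends it to arrows.\<close>

lemma deck_eqI:
  assumes F: "cat_functor Om Om F" "functor_comp Om p F = p"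
    and K: "cat_functor Om Om K" "functor_comp Om p K = p" and e: "obm F v = obm K v"
  shows "F = K"
proof (rule fmap_eqI[OF F(1) K(1)])
  have o: "obm F u = obm K u" if u: "u \<in> Obj Om" for u
  proof -
    obtain a where a: "a \<in> Arr G" "src G a = x" "act a v = u" using transitive[OF u] by blast
    then show ?thesis using act_deck[OF F a(1) v] act_deck[OF K a(1) v] e by simp
  qed
  then show "obm F u = obm K u" if "u \<in> Obj Om" for u using that .
  show "arm F l = arm K l" if "l \<in> Arr Om" for l
    using that o[of "src Om l"]
    by (intro lift_eqI) (simp_all add: cOm cat_functor_simps[OF F(1)] cat_functor_simps[OF K(1)] deck_p[OF F(2)] deck_p[OF K(2)])
qed

text \<open>It suffices to compare values at \<open>v\<close>: \<open>tr c'\<close> sends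
  \<open>v\<close> to \<open>c'v\<close>, which \<open>tr c\<close> sends to \<open>c'cv\<close>.
  Hence the order is reversed.\<close>

lemma functor_comp_tr:
  assumes c: "c \<in> norm_stab" "c' \<in> norm_stab"
  shows "functor_comp Om (tr c) (tr c') = tr (cmp G c' c)"
proof (rule deck_eqI)
  note n = norm_stab_Arr[OF c(1)] norm_stab_Arr[OF c(2)]
  show "cat_functor Om Om (functor_comp Om (tr c) (tr c'))"
    by (rule cat_functor_functor_comp[OF catOm cat_functor_tr[OF c(2)] cat_functor_tr[OF c(1)]])
  show "functor_comp Om p (functor_comp Om (tr c) (tr c')) = p"
    by (simp add: functor_comp_assoc[OF cat_functor_tr, symmetric] p_tr c)
  show "cat_functor Om Om (tr (cmp G c' c))" "functor_comp Om p (tr (cmp G c' c)) = p"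
    by (simp_all add: cat_functor_tr p_tr cmp_norm_stab c)
  show "obm (functor_comp Om (tr c) (tr c')) v = obm (tr (cmp G c' c)) v"
    using act_Obj[of c' v] v n vtranslate[OF c(1), of c']
    by (simp add: functor_comp_def compose_def obm_tr_v c cmp_norm_stab tr_simps(1)[OF c(1)])
qed

lemma tr_idn: "tr (idn G x) = functor_id Om"
proof (rule deck_eqI)
  show "functor_comp Om p (functor_id Om) = p" by (rule functor_comp_functor_id[OF p])
  show "obm (tr (idn G x)) v = obm (functor_id Om) v"
    using act_idn[OF v] v by (simp add: obm_tr_v[OF idn_norm_stab] functor_id_def)
qed (simp_all add: cat_functor_tr p_tr idn_norm_stab cat_functor_functor_id catOm)

text \<open>The inverse is the translation by \<open>ginv G c\<close>. Degrees are preserved because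
  \<open>p\<close> preserves them and an arrow and its translate have the same image.\<close>

lemma tr_Aut_cov:
  assumes c: "c \<in> norm_stab"
  shows "tr c \<in> carrier (Aut_cov Om p)"
proof -
  have m: "kgraph_morphism Om Om (tr b)" if b: "b \<in> norm_stab" for b
    using cat_functor_tr[OF b] right_action(1,2)[OF b] deg_p
    unfolding kgraph_morphism_def by (metis tr_simps(2)[OF b])
  have "functor_comp Om (tr c) (tr (ginv G c)) = functor_id Om"
    "functor_comp Om (tr (ginv G c)) (tr c) = functor_id Om"
    using ginv[OF norm_stab_Arr(1)[OF c]] norm_stab_Arr[OF c] by (simp_all add: functor_comp_tr ginv_norm_stab c tr_idn)
  then show ?thesis
    using m[OF c] m[OF ginv_norm_stab[OF c]] p_tr[OF c] by (auto simp: Aut_cov_def kgraph_automorphism_def)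
qed

text \<open>Choose \<open>c\<close> with \<open>cv = F(v)\<close>. As \<open>F\<close> is
  equivariant and injective, \<open>v\<close> and \<open>cv\<close> have the same stabilizer, so
  \<open>c\<close> lies in the normalizer; then \<open>F\<close> and \<open>tr c\<close> agree at
  \<open>v\<close>.\<close>

lemma Aut_cov_tr:
  assumes F: "F \<in> carrier (Aut_cov Om p)"
  shows "\<exists>c\<in>norm_stab. F = tr c"
proof -
  obtain F' where F1: "cat_functor Om Om F" and p1: "functor_comp Om p F = p"
    and F': "cat_functor Om Om F'" "functor_comp Om F' F = functor_id Om"
    using F by (auto simp: Aut_cov_def kgraph_automorphism_def kgraph_morphism_def)
  have inj: "u = w" if "u \<in> Obj Om" "w \<in> Obj Om" "obm F u = obm F w" for u w
    using arg_cong[OF F'(2), of "\<lambda>K. obm K u"] arg_cong[OF F'(2), of "\<lambda>K. obm K w"] that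
    by (simp add: functor_comp_def functor_id_def compose_def)
  have Fv: "obm F v \<in> Obj Om" "obm p (obm F v) = x"
    using cat_functor_simps(1)[OF F1 v] deck_p(1)[OF p1 v] by simp_all
  obtain c where c: "c \<in> Arr G" "src G c = x" "act c v = obm F v" using transitive[OF Fv(1)] by blast
  have "rng G c = x" using act_Obj(2)[of c v] c v Fv by simp
  then have c1: "c \<in> carrier \<pi>" using c by (simp add: carrier_\<pi>)
  have "act h v = v \<longleftrightarrow> act h (act c v) = act c v" if h: "h \<in> carrier \<pi>" for h
  proof -
    have h': "h \<in> Arr G" "src G h = x" using h by (simp_all add: carrier_\<pi>)
    have "act h (act c v) = obm F (act h v)" using act_deck[OF F1 p1 h'(1) v] h' c by simp
    then show ?thesis using inj[OF act_Obj(1)[OF h'(1) v] v] h' c by auto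
  qed
  then have "c \<in> norm_stab" using c1 by (simp add: mem_norm_stab)
  moreover from this have "F = tr c"
    by (intro deck_eqI F1 p1 cat_functor_tr p_tr) (simp_all add: obm_tr_v c)
  ultimately show ?thesis by blast
qed

lemma right_action_idn: "l \<in> Arr Om \<Longrightarrow> right_action Om p G i v l (idn G x) = l"
  using arg_cong[OF tr_idn, of "\<lambda>K. arm K l"] by (simp add: tr_simps[OF idn_norm_stab] functor_id_def)

text \<open>The arrow part of \<open>functor_comp_tr\<close> with the factors exchanged: the
  reversal there is the law of a right action here.\<close>

lemma right_action_cmp:
  assumes "c \<in> norm_stab" "c' \<in> norm_stab" "l \<in> Arr Om"
  shows "right_action Om p G i v l (cmp G c c') = right_action Om p G i v (right_action Om p G i v l c) c'"
  using arg_cong[OF functor_comp_tr[OF assms(2,1)], of "\<lambda>K. arm K l"] assms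
  by (simp add: tr_simps cmp_norm_stab right_action functor_comp_def compose_def)

section \<open>The isomorphism with the quotient of the normalizer\<close>

lemma Aut_cov_iso: "Aut_cov Om p \<cong> \<pi>\<lparr>carrier := norm_stab\<rparr> Mod stab"
proof -
  \<comment> \<open>\<open>c \<mapsto> tr c\<close> reverses products, so it is composed with inversion.\<close>
  let ?N = "\<pi>\<lparr>carrier := norm_stab\<rparr>" and ?h = "\<lambda>c. tr (ginv G c)"
  interpret N: group ?N by (rule subgroup.subgroup_is_group[OF subgroup_norm_stab group_\<pi>])
  have gi: "ginv G (ginv G c) = c" if "c \<in> norm_stab" for c
    using group.inv_inv[OF group_\<pi>, of c] that ginv_norm_stab[OF that] by (simp add: norm_stab_carrier inv_\<pi>(1))
  have mult: "c \<otimes>\<^bsub>\<pi>\<^esub> c' = cmp G c c'" for c c' by (simp add: isotropy_group_def)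
  have "ginv G (cmp G c c') = cmp G (ginv G c') (ginv G c)" if "c \<in> norm_stab" "c' \<in> norm_stab" for c c'
    using group.inv_mult_group[OF group_\<pi>, of c c'] that cmp_norm_stab[OF that]
    by (simp add: mult norm_stab_carrier inv_\<pi>(1))
  then have hom: "?h \<in> hom ?N (Aut_cov Om p)"
    by (intro homI) (simp_all add: tr_Aut_cov ginv_norm_stab, simp add: isotropy_group_def Aut_cov_def functor_comp_tr ginv_norm_stab)
  have img: "?h ` carrier ?N = carrier (Aut_cov Om p)"
  proof (intro equalityI subsetI)
    fix F assume "F \<in> carrier (Aut_cov Om p)"
    then obtain c where "c \<in> norm_stab" "F = tr c" using Aut_cov_tr by blast
    then show "F \<in> ?h ` carrier ?N" by (intro image_eqI[of _ _ "ginv G c"]) (simp_all add: gi ginv_norm_stab)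
  qed (auto simp: tr_Aut_cov ginv_norm_stab)
  have "ginv G (idn G x) = idn G x"
    using monoid.inv_one[OF group.is_monoid[OF group_\<pi>]] inv_\<pi>(1)[of "idn G x"] idn_norm_stab
    by (simp add: norm_stab_carrier) (simp add: isotropy_group_def)
  \<comment> \<open>The group laws are inherited from \<open>?N\<close>, since \<open>?h\<close> is
    a homomorphism onto \<open>Aut_cov Om p\<close> that sends the unit to
    \<open>functor_id Om\<close>.\<close>
  then have "group (Aut_cov Om p)"
    using N.hom_imp_img_group[OF hom] unfolding img
    by (simp add: isotropy_group_def tr_idn Aut_cov_def)
  then interpret h: group_hom ?N "Aut_cov Om p" ?h
    using hom by (simp add: group_hom_def group_hom_axioms_def N.group_axioms)
  \<comment> \<open>By \<open>deck_eqI\<close> a translation is the identity exactly when it fixes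
    \<open>v\<close>, and \<open>c\<close> fixes \<open>v\<close> if and only if its inverse
    does.\<close>
  have "tr (ginv G c) = functor_id Om \<longleftrightarrow> c \<in> stab" if c: "c \<in> norm_stab" for c
  proof -
    note n = norm_stab_Arr[OF c]
    have "tr (ginv G c) = tr (idn G x) \<longleftrightarrow> act (ginv G c) v = v"
      using obm_tr_v[OF ginv_norm_stab[OF c]] obm_tr_v[OF idn_norm_stab] act_idn[OF v]
      by (metis deck_eqI cat_functor_tr p_tr ginv_norm_stab[OF c] idn_norm_stab)
    also have "\<dots> \<longleftrightarrow> act c v = v"
      using act_ginv_act[of c v] act_act_ginv[of c v] n v by auto
    finally show ?thesis using c by (simp add: tr_idn stab_def norm_stab_carrier)
  qed
  then have "kernel ?N (Aut_cov Om p) ?h = stab"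
    using stab_subset_norm_stab by (auto simp: kernel_def Aut_cov_def)
  then have "?N Mod stab \<cong> Aut_cov Om p" using h.FactGroup_iso[OF img] by simp
  \<comment> \<open>The first isomorphism theorem gives the isomorphism from the quotient; reversing
    it requires the quotient to be a group.\<close>
  moreover have "group (?N Mod stab)"
    using normal.factorgroup_is_group[OF h.normal_kernel] \<open>kernel ?N (Aut_cov Om p) ?h = stab\<close> by simp
  ultimately show ?thesis using group.iso_sym by blast
qed

end

text \<open>Since \<open>right_action\<close> rests on choice and description operators, the first
  conjunct certifies that an admissible \<open>a\<close> exists and that each one singles out the
  same element.\<close>

theorem theorem2p5:
  fixes k :: nat
    and \<Omega> :: "('w, 'f) graded_cat"
    and \<Lambda> :: "('v, 'e) graded_cat"
    and p :: "('w, 'f, 'v, 'e) fmap"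
    and G\<Omega> :: "('w, 'h) small_cat"
    and i\<Omega> :: "('w, 'f, 'w, 'h) fmap"
    and G\<Lambda> :: "('v, 'g) small_cat"
    and i\<Lambda> :: "('v, 'e, 'v, 'g) fmap"
    and x :: 'v and v :: 'w
    and H N :: "'g set"
  assumes "covering k \<Omega> \<Lambda> p"
    and "connected_cat \<Omega>"
    and "fundamental_groupoid \<Omega> G\<Omega> i\<Omega>"
    and "fundamental_groupoid \<Lambda> G\<Lambda> i\<Lambda>"
    and "x \<in> Obj \<Lambda>"
    and "v \<in> fibre \<Omega> p x"
    and "H = arm (induced_functor \<Omega> G\<Omega> i\<Omega> G\<Lambda> i\<Lambda> p) ` carrier (isotropy_group G\<Omega> v)"
    and "N = normalizer (isotropy_group G\<Lambda> x) H"
  shows "(\<forall>c\<in>N. \<forall>l\<in>Arr \<Omega>. (\<exists>a. connects \<Omega> p G\<Lambda> i\<Lambda> v l a) \<and>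
            (\<forall>a. connects \<Omega> p G\<Lambda> i\<Lambda> v l a \<longrightarrow>
               (\<forall>m. is_translate \<Omega> p G\<Lambda> i\<Lambda> v l a c m \<longleftrightarrow> m = right_action \<Omega> p G\<Lambda> i\<Lambda> v l c))) \<and>
         (\<forall>c\<in>N. translation \<Omega> p G\<Lambda> i\<Lambda> v c \<in> carrier (Aut_cov \<Omega> p)) \<and>
         (\<forall>l\<in>Arr \<Omega>. right_action \<Omega> p G\<Lambda> i\<Lambda> v l (idn G\<Lambda> x) = l) \<and>
         (\<forall>c\<in>N. \<forall>c'\<in>N. \<forall>l\<in>Arr \<Omega>. right_action \<Omega> p G\<Lambda> i\<Lambda> v l (cmp G\<Lambda> c c') =
            right_action \<Omega> p G\<Lambda> i\<Lambda> v (right_action \<Omega> p G\<Lambda> i\<Lambda> v l c) c') \<and>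
         Aut_cov \<Omega> p \<cong> (isotropy_group G\<Lambda> x)\<lparr>carrier := N\<rparr> Mod H"
proof -
  have base: "v \<in> Obj \<Omega>" "x = obm p v" using assms(6) by (auto simp: fibre_def)
  interpret connected_covering k \<Omega> \<Lambda> p G\<Lambda> i\<Lambda> v
    using assms(1,2,4) base by unfold_locales
  have "H = stab"
    unfolding assms(7) stab_def by (rule image_isotropy_group[OF assms(3) base(1)])
  moreover from this have "N = norm_stab"
    by (simp add: assms(8) norm_stab_def base(2))
  ultimately show ?thesis
    using connects_exists is_translate_iff right_action_eq tr_Aut_cov right_action_idn right_action_cmp
      Aut_cov_iso
    by (simp add: base(2))
qed

end
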